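(* Let $(\Omega,|\cdot|)$ be a $\sigma$-finite measure space with a basis of sets $\mathcal{E}$. Let $r_1,r_2\in[1,\infty)$, $q_1,q_2\in(0,\infty]$ with $\frac1q=\frac1{q_1}+\frac1{q_2}\in(0,\infty)$. Let $X_1,X_2$ be $q$-convex quasi-Banach function spaces over $\Omega$ and suppose: (a) if $q_2\neq\infty$, there exists a positive isometric isomorphism $L_1:X_1^q\to(X_2^q)'$, and $M^{\mathcal{E}}_{r_1}:X_1^q\to(X_2^q)'$ is bounded; (b) if $q_1\neq\infty$, there exists a positive isometric isomorphism $L_2:X_2^q\to(X_1^q)'$, and $M^{\mathcal{E}}_{r_2}:X_2^q\to(X_1^q)'$ is bounded. Then for every $f_1\in X_1$, $f_2\in X_2$ there exist weights $W_1,W_2$ such that \[ \sup_{E\in\mathcal{E}}\langle W_1^{-1}\rangle_{r_1q_2,E}\langle W_2^{-1}\rangle_{r_2q_1,E}\leq2^{\frac1q}\|M^{\mathcal{E}}_{r_1}\|^{\frac1{q_2}}_{X_1^q\to(X_2^q)'}\|M^{\mathcal{E}}_{r_2}\|^{\frac1{q_1}}_{X_2^q\to(X_1^q)'} \] and \[ \|f_1W_1\|_{L^{q_1}(\Omega)}\|f_2W_2\|_{L^{q_2}(\Omega)}\leq2^{\frac1q}\|f_1\|_{X_1}\|f_2\|_{X_2}. \] Moreover, suppose $X$ is a $q$-convex quasi-Banach function space over $\Omega$ such that: if $q_2\neq\infty$, then $M^{\mathcal{E}}_{r_1}:X^q\to X^q$ is bounded; and if $q_1\neq\infty$, then $M^{\mathcal{E}}_{r_2}:(X^q)'\to(X^q)'$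 is bounded. Then for each $f\in X$, $g\in[(X^q)']^{\frac1q}$ there is a weight $W$ such that \[ \sup_{E\in\mathcal{E}}\langle W\rangle_{r_2q_1,E}\langle W^{-1}\rangle_{r_1q_2,E}\leq2^{\frac1q}\|M^{\mathcal{E}}_{r_1}\|^{\frac1{q_2}}_{X^q\to X^q}\|M^{\mathcal{E}}_{r_2}\|^{\frac1{q_1}}_{(X^q)'\to(X^q)'} \] and \[ \|fW\|_{L^{q_1}(\Omega)}\|gW^{-1}\|_{L^{q_2}(\Omega)}\leq2^{\frac1q}\|f\|_X\|g\|_{[(X^q)']^{\frac1q}}. \]
   Context: Conventions: $\frac1\infty=0$; factors raised to the power $0$ are read as $1$. A weight is a measurable function with $0<W<\infty$ a.e.; $L^0(\Omega)$: a.e. finite measurable functions. A basis of sets in $\Omega$ is a collection $\mathcal{E}$ of measurable sets $E$ with $0<|E|<\infty$ such that (1) $\bigcup_{E\in\mathcal{E}}E=\Omega$; (2) any $x_1,x_2\in\Omega$ lie in a common $E\in\mathcal{E}$; (3) there is a countable $\mathcal{E}'\subseteq\mathcal{E}$ such that for all $\varepsilon>0$, $E\in\mathcal{E}$ there is $E'\in\mathcal{E}'$ with $E\subseteq E'$, $|E'|\le(1+\varepsilon)|E|$. $\langle f\rangle_{p,E}=|E|^{-1/p}\|f\mathbf{1}_E\|_{L^p(\Omega)}$ for $p\in(0,\infty]$, $M_p^{\mathcal{E}}f=\sup_{E\in\mathcal{E}}\langle f\rangle_{p,E}\mathbf{1}_E$. A quasi-Banach function space over $\Omega$ is a vector space $X\subseteq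 L^0(\Omega)$ with a quasi-norm such that: (ideal) $f\in X$, $g\in L^0$, $|g|\le|f|$ imply $g\in X$, $\|g\|_X\le\|f\|_X$; (Fatou) $0\le f_n\uparrow f$, $f_n\in X$, $\sup_n\|f_n\|_X<\infty$ imply $f\in X$, $\|f\|_X=\sup_n\|f_n\|_X$; (saturation) every measurable set of positive measure contains a measurable $F$ of positive measure with $\mathbf{1}_F\in X$. $X'=\{g\in L^0: fg\in L^1\ \forall f\in X\}$, $\|g\|_{X'}=\sup_{\|f\|_X=1}\|fg\|_{L^1}$. For $t\in(0,\infty)$, $X^t=\{f:|f|^{1/t}\in X\}$, $\|f\|_{X^t}=\||f|^{1/t}\|_X^t$. $X$ is $q$-convex if $\|(|f|^q+|g|^q)^{1/q}\|_X\le(\|f\|_X^q+\|g\|_X^q)^{1/q}$ for all $f,g\in X$. Isomorphisms are linear; positive means mapping nonnegative functions to nonnegative functions. *)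

theory Defs
  imports "HOL-Probability.Essential_Supremum"
begin

text \<open>
  Elements of \<open>L\<^sup>0(\<Omega>)\<close> are represented by real-valued measurable functions. As for
  \<open>integrable\<close>, functions are not quotiented by almost everywhere equality; every notion below
  is instead invariant under changes on null sets.
\<close>

subsection \<open>Lebesgue quasi-norms, averages and maximal operators\<close>

text \<open>Powers of elements of \<open>[0,\<infinity>]\<close>; only used for exponents \<open>a > 0\<close>.\<close>

definition ennpowr :: "ennreal \<Rightarrow> real \<Rightarrow> ennreal" where
  "ennpowr x a = (if x = \<infinity> then \<infinity> else ennreal (enn2real x powr a))"

text \<open>HOL has \<open>0 powr 0 = 0\<close>, whereas here factors raised to the power \<open>0\<close> are read as \<open>1\<close>.\<close>

definition powr1 :: "real \<Rightarrow> real \<Rightarrow> real" where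
  "powr1 x a = (if a = 0 then 1 else x powr a)"

definition Lp_norm :: "'a measure \<Rightarrow> ennreal \<Rightarrow> ('a \<Rightarrow> real) \<Rightarrow> ennreal" where
  "Lp_norm M p f =
    (if p = \<infinity> then esssup M (\<lambda>x. ennreal \<bar>f x\<bar>)
     else ennpowr (\<integral>\<^sup>+ x. ennreal (\<bar>f x\<bar> powr enn2real p) \<partial>M) (1 / enn2real p))"

definition avg :: "'a measure \<Rightarrow> ennreal \<Rightarrow> 'a set \<Rightarrow> ('a \<Rightarrow> real) \<Rightarrow> ennreal" where
  "avg M p E f =
    ennreal (measure M E powr (- enn2real (inverse p))) * Lp_norm M p (\<lambda>x. f x * indicator E x)"

definition set_basis :: "'a measure \<Rightarrow> 'a set set \<Rightarrow> bool" where
  "set_basis M \<E> \<longleftrightarrow>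
    (\<forall>E\<in>\<E>. E \<in> sets M \<and> 0 < emeasure M E \<and> emeasure M E < \<infinity>) \<and>
    \<Union>\<E> = space M \<and>
    (\<forall>x1\<in>space M. \<forall>x2\<in>space M. \<exists>E\<in>\<E>. x1 \<in> E \<and> x2 \<in> E) \<and>
    (\<exists>\<E>'\<subseteq>\<E>. countable \<E>' \<and>
      (\<forall>\<epsilon>>0. \<forall>E\<in>\<E>. \<exists>E'\<in>\<E>'. E \<subseteq> E' \<and> measure M E' \<le> (1 + \<epsilon>) * measure M E))"

definition maximal_op ::
    "'a measure \<Rightarrow> 'a set set \<Rightarrow> ennreal \<Rightarrow> ('a \<Rightarrow> real) \<Rightarrow> 'a \<Rightarrow> ennreal" where
  "maximal_op M \<E> p f x = (SUP E\<in>\<E>. avg M p E f * indicator E x)"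

definition weight :: "'a measure \<Rightarrow> ('a \<Rightarrow> real) \<Rightarrow> bool" where
  "weight M W \<longleftrightarrow> W \<in> borel_measurable M \<and> (AE x in M. 0 < W x)"


subsection \<open>Quasi-Banach function spaces\<close>

record 'a fspace =
  fcarrier :: "('a \<Rightarrow> real) set"
  fnorm :: "('a \<Rightarrow> real) \<Rightarrow> real"

definition quasi_normed_fspace :: "'a measure \<Rightarrow> 'a fspace \<Rightarrow> bool" where
  "quasi_normed_fspace M X \<longleftrightarrow>
    fcarrier X \<subseteq> borel_measurable M \<and>
    (\<lambda>x. 0) \<in> fcarrier X \<and>
    (\<forall>f\<in>fcarrier X. \<forall>g\<in>fcarrier X. (\<lambda>x. f x + g x) \<in> fcarrier X) \<and>
    (\<forall>c. \<forall>f\<in>fcarrier X. (\<lambda>x. c * f x) \<in> fcarrier X) \<and>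
    (\<forall>f\<in>fcarrier X. 0 \<le> fnorm X f) \<and>
    (\<forall>f\<in>fcarrier X. fnorm X f = 0 \<longleftrightarrow> (AE x in M. f x = 0)) \<and>
    (\<forall>c. \<forall>f\<in>fcarrier X. fnorm X (\<lambda>x. c * f x) = \<bar>c\<bar> * fnorm X f) \<and>
    (\<exists>K\<ge>1. \<forall>f\<in>fcarrier X. \<forall>g\<in>fcarrier X.
       fnorm X (\<lambda>x. f x + g x) \<le> K * (fnorm X f + fnorm X g))"

text \<open>
  The ideal property also makes the carrier and the quasi-norm invariant under almost everywhere
  equality. Completeness is not listed: it follows from the Fatou property.
\<close>

definition qbfs :: "'a measure \<Rightarrow> 'a fspace \<Rightarrow> bool" where
  "qbfs M X \<longleftrightarrow>
    quasi_normed_fspace M X \<and>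
    (\<forall>f\<in>fcarrier X. \<forall>g\<in>borel_measurable M.
       (AE x in M. \<bar>g x\<bar> \<le> \<bar>f x\<bar>) \<longrightarrow> g \<in> fcarrier X \<and> fnorm X g \<le> fnorm X f) \<and>
    (\<forall>F. \<forall>f\<in>borel_measurable M.
       (\<forall>n::nat. F n \<in> fcarrier X) \<and>
       (AE x in M. (\<forall>n. 0 \<le> F n x \<and> F n x \<le> F (Suc n) x) \<and> (\<lambda>n. F n x) \<longlonglongrightarrow> f x) \<and>
       bdd_above (range (\<lambda>n. fnorm X (F n)))
       \<longrightarrow> f \<in> fcarrier X \<and> fnorm X f = (SUP n. fnorm X (F n))) \<and>
    (\<forall>A\<in>sets M. 0 < emeasure M A \<longrightarrow>
       (\<exists>F\<in>sets M. F \<subseteq> A \<and> 0 < emeasure M F \<and> indicator F \<in> fcarrier X))"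

text \<open>
  The supremum in the norm is taken in \<open>[0,\<infinity>]\<close>, so that it is \<open>0\<close> if \<open>X\<close> has no element of
  norm \<open>1\<close>. It is finite whenever \<open>X\<close> is a Banach function space, by a gliding hump argument.
\<close>

definition koethe_dual :: "'a measure \<Rightarrow> 'a fspace \<Rightarrow> 'a fspace" where
  "koethe_dual M X =
    \<lparr>fcarrier = {g \<in> borel_measurable M. \<forall>f\<in>fcarrier X. integrable M (\<lambda>x. f x * g x)},
     fnorm = (\<lambda>g. enn2real
       (SUP f\<in>{f \<in> fcarrier X. fnorm X f = 1}. \<integral>\<^sup>+ x. ennreal \<bar>f x * g x\<bar> \<partial>M))\<rparr>"

definition concavification :: "'a measure \<Rightarrow> 'a fspace \<Rightarrow> real \<Rightarrow> 'a fspace" where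
  "concavification M X t =
    \<lparr>fcarrier = {f \<in> borel_measurable M. (\<lambda>x. \<bar>f x\<bar> powr (1 / t)) \<in> fcarrier X},
     fnorm = (\<lambda>f. fnorm X (\<lambda>x. \<bar>f x\<bar> powr (1 / t)) powr t)\<rparr>"

definition q_convex :: "real \<Rightarrow> 'a fspace \<Rightarrow> bool" where
  "q_convex q X \<longleftrightarrow>
    (\<forall>f\<in>fcarrier X. \<forall>g\<in>fcarrier X.
       fnorm X (\<lambda>x. (\<bar>f x\<bar> powr q + \<bar>g x\<bar> powr q) powr (1 / q))
         \<le> (fnorm X f powr q + fnorm X g powr q) powr (1 / q))"


subsection \<open>Operators between function spaces\<close>

text \<open>
  Linearity and surjectivity are up to null sets, that is, they hold for the classes. That \<open>L\<close>
  respects almost everywhere equality and is injective on classes follows, since a linear isometry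
  sends precisely the functions vanishing almost everywhere to such functions.
\<close>

definition positive_isometric_iso ::
    "'a measure \<Rightarrow> 'a fspace \<Rightarrow> 'a fspace \<Rightarrow> (('a \<Rightarrow> real) \<Rightarrow> 'a \<Rightarrow> real) \<Rightarrow> bool" where
  "positive_isometric_iso M X Y L \<longleftrightarrow>
    (\<forall>f\<in>fcarrier X. L f \<in> fcarrier Y) \<and>
    (\<forall>f\<in>fcarrier X. \<forall>g\<in>fcarrier X. AE x in M. L (\<lambda>y. f y + g y) x = L f x + L g x) \<and>
    (\<forall>c. \<forall>f\<in>fcarrier X. AE x in M. L (\<lambda>y. c * f y) x = c * L f x) \<and>
    (\<forall>g\<in>fcarrier Y. \<exists>f\<in>fcarrier X. AE x in M. L f x = g x) \<and>
    (\<forall>f\<in>fcarrier X. fnorm Y (L f) = fnorm X f) \<and>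
    (\<forall>f\<in>fcarrier X. (AE x in M. 0 \<le> f x) \<longrightarrow> (AE x in M. 0 \<le> L f x))"

text \<open>
  A \<open>[0,\<infinity>]\<close>-valued function belongs to \<open>Y\<close> if it is finite almost everywhere and its
  real-valued representative does.
\<close>

definition op_bounded ::
    "'a measure \<Rightarrow> 'a fspace \<Rightarrow> 'a fspace \<Rightarrow> (('a \<Rightarrow> real) \<Rightarrow> 'a \<Rightarrow> ennreal) \<Rightarrow> bool" where
  "op_bounded M X Y T \<longleftrightarrow>
    (\<forall>f\<in>fcarrier X. (AE x in M. T f x < \<infinity>) \<and> (\<lambda>x. enn2real (T f x)) \<in> fcarrier Y) \<and>
    (\<exists>C\<ge>0. \<forall>f\<in>fcarrier X. fnorm Y (\<lambda>x. enn2real (T f x)) \<le> C * fnorm X f)"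

text \<open>The norm is only meaningful for operators that are bounded in the above sense.\<close>

definition op_norm ::
    "'a fspace \<Rightarrow> 'a fspace \<Rightarrow> (('a \<Rightarrow> real) \<Rightarrow> 'a \<Rightarrow> ennreal) \<Rightarrow> real" where
  "op_norm X Y T =
    Inf {C. 0 \<le> C \<and> (\<forall>f\<in>fcarrier X. fnorm Y (\<lambda>x. enn2real (T f x)) \<le> C * fnorm X f)}"

end

theory Submission
  imports Defs "HOL-Real_Asymp.Real_Asymp"
begin

text \<open>
  Passing from \<open>X1\<close> and \<open>X2\<close> to their \<open>q\<close>-concavifications \<open>Y1\<close> and \<open>Y2\<close>, for which
  \<open>q\<close>-convexity becomes the triangle inequality, one works with honest Banach function spaces.
  The weights come from the Rubio de Francia algorithm (\<open>rubio_de_francia\<close>). Applied to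
  \<open>\<bar>f1\<bar> powr q\<close>, it gives a majorant \<open>w1\<close> of at most twice the norm whose maximal function is at
  most \<open>2 * K1 * u1\<close>, where \<open>u1\<close> is the image of \<open>w1\<close> in the dual of \<open>Y2\<close> and \<open>K1\<close> is the
  norm of the maximal operator; \<open>w2\<close> and \<open>u2\<close> arise in the same way from \<open>\<bar>f2\<bar> powr q\<close>. The
  weights are
  \<open>W1 = w1 powr (- 1 / q2) * u2 powr (1 / q1)\<close> and \<open>W2 = w2 powr (- 1 / q1) * u1 powr (1 / q2)\<close>.
  On a set of the basis, \<open>u1\<close> and \<open>u2\<close> are bounded below by multiples of the averages of \<open>w1\<close>
  and \<open>w2\<close>, and these averages cancel in the product of the averages of the reciprocal weights
  (\<open>weight_averages_le\<close>). Since \<open>u2\<close> lies in the dual of \<open>Y1\<close> and \<open>u1\<close> in that of \<open>Y2\<close>,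
  the weighted norms are controlled by the duality pairing (\<open>weight_factorization\<close>).

  For one space \<open>X\<close>, with concavification \<open>Y\<close>, the same construction is carried out with \<open>Y\<close>
  and its dual in the roles of \<open>Y1\<close> and \<open>Y2\<close>, and with identity maps as isometries. Then
  \<open>u1 = w1\<close> and \<open>u2 = w2\<close>, so the two weights are reciprocal to each other.

  Three facts support this. The iteration needs the isometry to have a positive inverse, which
  holds for every positive surjective isometry (\<open>L_reflects_nonneg\<close>). The pairing needs the
  norm of the dual to be finite, which is a gliding hump argument (\<open>dual_bounded\<close>). Finally the
  dual has to contain enough functions for the iteration to start there with a nonzero one; such
  functions are derivatives of a convex functional at its minimiser over the unit ball
  (\<open>dual_positive_on\<close>).
\<close>

section \<open>Banach function spaces\<close>

lemma emeasure_pos_if_not_AE: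
  assumes "\<not> (AE x in M. P x)" "{x \<in> space M. \<not> P x} \<in> sets M"
  shows "0 < emeasure M {x \<in> space M. \<not> P x}"
  using assms AE_I[OF order_refl _ assms(2)] not_gr_zero by blast

text \<open>
  The spaces with a norm rather than a quasi-norm. The Fatou property is stated with an arbitrary
  bound \<open>C\<close>, which has the same content as the supremum of the norms and is easier to verify for
  the dual.
\<close>

locale banach_fspace = sigma_finite_measure M for M :: "'a measure" +
  fixes Y :: "'a fspace"
  assumes meas: "f \<in> fcarrier Y \<Longrightarrow> f \<in> borel_measurable M"
    and zero_mem: "(\<lambda>x. 0) \<in> fcarrier Y"
    and add_mem: "f \<in> fcarrier Y \<Longrightarrow> g \<in> fcarrier Y \<Longrightarrow> (\<lambda>x. f x + g x) \<in> fcarrier Y"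
    and scale_mem: "f \<in> fcarrier Y \<Longrightarrow> (\<lambda>x. c * f x) \<in> fcarrier Y"
    and norm_nonneg: "f \<in> fcarrier Y \<Longrightarrow> 0 \<le> fnorm Y f"
    and norm_eq_0D: "f \<in> fcarrier Y \<Longrightarrow> fnorm Y f = 0 \<Longrightarrow> AE x in M. f x = 0"
    and norm_scale: "f \<in> fcarrier Y \<Longrightarrow> fnorm Y (\<lambda>x. c * f x) = \<bar>c\<bar> * fnorm Y f"
    and norm_triangle: "f \<in> fcarrier Y \<Longrightarrow> g \<in> fcarrier Y \<Longrightarrow>
          fnorm Y (\<lambda>x. f x + g x) \<le> fnorm Y f + fnorm Y g"
    and ideal: "f \<in> fcarrier Y \<Longrightarrow> g \<in> borel_measurable M \<Longrightarrow> AE x in M. \<bar>g x\<bar> \<le> \<bar>f x\<bar> \<Longrightarrow>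
          g \<in> fcarrier Y \<and> fnorm Y g \<le> fnorm Y f"
    and fatou: "(\<And>n. F n \<in> fcarrier Y) \<Longrightarrow> f \<in> borel_measurable M \<Longrightarrow>
          (AE x in M. (\<forall>n::nat. 0 \<le> F n x \<and> F n x \<le> F (Suc n) x) \<and> (\<lambda>n. F n x) \<longlonglongrightarrow> f x) \<Longrightarrow>
          (\<And>n. fnorm Y (F n) \<le> C) \<Longrightarrow> f \<in> fcarrier Y \<and> fnorm Y f \<le> C"
    and saturated: "A \<in> sets M \<Longrightarrow> 0 < emeasure M A \<Longrightarrow>
          \<exists>B\<in>sets M. B \<subseteq> A \<and> 0 < emeasure M B \<and> indicator B \<in> fcarrier Y"

context banach_fspace
begin

lemma norm_null: 
  assumes "f \<in> borel_measurable M" "AE x in M. f x = 0"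
  shows "f \<in> fcarrier Y" "fnorm Y f = 0"
proof -
  have "fnorm Y (\<lambda>x. 0 * (0::real)) = 0"
    using norm_scale[OF zero_mem, of 0] by simp
  moreover have "f \<in> fcarrier Y \<and> fnorm Y f \<le> fnorm Y (\<lambda>x. 0)"
    using assms by (intro ideal zero_mem) auto
  ultimately show "f \<in> fcarrier Y" "fnorm Y f = 0"
    using norm_nonneg[of f] by auto
qed

lemma mem_AE_cong:
  assumes "f \<in> fcarrier Y" "g \<in> borel_measurable M" "AE x in M. g x = f x"
  shows "g \<in> fcarrier Y" "fnorm Y g = fnorm Y f"
proof -
  have 1: "g \<in> fcarrier Y \<and> fnorm Y g \<le> fnorm Y f"
    using assms by (intro ideal) auto
  then have "fnorm Y f \<le> fnorm Y g"
    using assms meas by (intro conjunct2[OF ideal]) auto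
  with 1 show "g \<in> fcarrier Y" "fnorm Y g = fnorm Y f" by auto
qed

lemma norm_mono:
  assumes "f \<in> fcarrier Y" "g \<in> fcarrier Y" "AE x in M. \<bar>g x\<bar> \<le> \<bar>f x\<bar>"
  shows "fnorm Y g \<le> fnorm Y f"
  using ideal[OF assms(1) meas[OF assms(2)] assms(3)] by simp

lemma abs_mem:
  assumes "f \<in> fcarrier Y"
  shows "(\<lambda>x. \<bar>f x\<bar>) \<in> fcarrier Y" "fnorm Y (\<lambda>x. \<bar>f x\<bar>) = fnorm Y f"
proof -
  note [measurable] = meas[OF assms]
  have 1: "(\<lambda>x. \<bar>f x\<bar>) \<in> fcarrier Y \<and> fnorm Y (\<lambda>x. \<bar>f x\<bar>) \<le> fnorm Y f"
    by (intro ideal assms) auto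
  then have "fnorm Y f \<le> fnorm Y (\<lambda>x. \<bar>f x\<bar>)"
    by (intro conjunct2[OF ideal]) auto
  with 1 show "(\<lambda>x. \<bar>f x\<bar>) \<in> fcarrier Y" "fnorm Y (\<lambda>x. \<bar>f x\<bar>) = fnorm Y f" by auto
qed

lemma diff_mem:
  assumes "f \<in> fcarrier Y" "g \<in> fcarrier Y"
  shows "(\<lambda>x. f x - g x) \<in> fcarrier Y"
  using add_mem[OF assms(1) scale_mem[OF assms(2), of "-1"]] by simp

lemma norm_indicator_pos:
  assumes "B \<in> sets M" "0 < emeasure M B" "indicator B \<in> fcarrier Y"
  shows "0 < fnorm Y (indicator B)"
proof (rule ccontr)
  assume "\<not> ?thesis"
  with norm_nonneg[OF assms(3)] have "fnorm Y (indicator B) = 0" by simp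
  from norm_eq_0D[OF assms(3) this] have "AE x in M. x \<notin> B"
    by eventually_elim (auto simp: indicator_def split: if_splits)
  then have "B \<in> null_sets M" using assms(1) by (simp add: AE_iff_null_sets)
  with assms(2) show False by (simp add: null_sets_def)
qed

text \<open>
  In the Fatou property the limit has to be finite. This is automatic: if the sequence were
  unbounded on a set of positive measure, then by saturation all multiples of some
  \<open>indicator B\<close> would have norm at most \<open>C\<close>.
\<close>

lemma increasing_limit:
  fixes F :: "nat \<Rightarrow> 'a \<Rightarrow> real"
  assumes F: "\<And>n. F n \<in> fcarrier Y" and inc: "AE x in M. \<forall>n. 0 \<le> F n x \<and> F n x \<le> F (Suc n) x"
    and C: "\<And>n. fnorm Y (F n) \<le> C"
  obtains f where "f \<in> fcarrier Y" "fnorm Y f \<le> C" "AE x in M. (\<lambda>n. F n x) \<longlonglongrightarrow> f x"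
    "AE x in M. \<forall>n. F n x \<le> f x" "\<And>x. 0 \<le> f x"
proof -
  note [measurable] = meas[OF F]
  define G where "G x = (SUP n. ennreal (F n x))" for x
  have [measurable]: "G \<in> borel_measurable M" unfolding G_def[abs_def] by measurable
  have C0: "0 \<le> C" using norm_nonneg[OF F] C order_trans by blast
  have fin: "AE x in M. G x \<noteq> \<infinity>"
  proof (rule ccontr)
    assume *: "\<not> ?thesis"
    define A where "A = {x \<in> space M. G x = \<infinity>}"
    have A: "A \<in> sets M" unfolding A_def by measurable
    have "0 < emeasure M A"
      using emeasure_pos_if_not_AE[OF *] A by (simp add: A_def not_less)
    from saturated[OF A this] obtain B where B: "B \<in> sets M" "B \<subseteq> A" "0 < emeasure M B"
      "indicator B \<in> fcarrier Y" by auto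
    note [measurable] = B(1)
    have bd: "R * fnorm Y (indicator B) \<le> C" if R: "0 < R" for R :: real
    proof -
      define H where "H n x = min (F n x) (R * indicator B x)" for n x
      have [measurable]: "H n \<in> borel_measurable M" for n unfolding H_def[abs_def] by measurable
      have H: "H n \<in> fcarrier Y \<and> fnorm Y (H n) \<le> fnorm Y (F n)" for n
        using inc R by (intro ideal F) (auto simp: H_def elim!: eventually_mono)
      have "AE x in M. (\<forall>n. 0 \<le> H n x \<and> H n x \<le> H (Suc n) x) \<and> (\<lambda>n. H n x) \<longlonglongrightarrow> R * indicator B x"
        using inc
      proof eventually_elim
        case (elim x)
        then have mono: "incseq (\<lambda>n. F n x)" by (auto intro: incseq_SucI)
        have "(\<lambda>n. H n x) \<longlonglongrightarrow> R * indicator B x"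
        proof (cases "x \<in> B")
          case True
          then have "G x = \<infinity>" using B(2) by (auto simp: A_def)
          then have "ennreal R < G x" by simp
          then obtain n where "ennreal R < ennreal (F n x)"
            unfolding G_def less_SUP_iff by auto
          then have n: "R \<le> F n x" using R by (simp add: ennreal_less_iff)
          have "\<forall>\<^sub>F m in sequentially. H m x = R * indicator B x"
            unfolding eventually_sequentially
            using n mono True by (intro exI[of _ n]) (auto simp: H_def min_def incseq_def
               intro: antisym order_trans)
          then show ?thesis by (rule tendsto_eventually)
        next
          case False
          then show ?thesis using elim by (auto simp: H_def min_absorb2)
        qed
        then show ?case using elim R by (auto simp: H_def min_le_iff_disj min.coboundedI1)
      qed
      from fatou[of H, OF _ _ this, of C] have "fnorm Y (\<lambda>x. R * indicator B x) \<le> C"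
        using H C order_trans by (auto simp: le_fun_def) blast
      then show ?thesis using norm_scale[OF B(4), of R] R by simp
    qed
    have p: "0 < fnorm Y (indicator B)" using norm_indicator_pos B by auto
    have "(C + 1) / fnorm Y (indicator B) * fnorm Y (indicator B) \<le> C"
      by (rule bd) (use p C0 in auto)
    then show False using p by simp
  qed
  define f where "f x = enn2real (G x)" for x
  have [measurable]: "f \<in> borel_measurable M" unfolding f_def[abs_def] by measurable
  have lim: "AE x in M. (\<forall>n. 0 \<le> F n x \<and> F n x \<le> F (Suc n) x) \<and> (\<lambda>n. F n x) \<longlonglongrightarrow> f x"
    using inc fin
  proof eventually_elim
    case (elim x)
    then have "incseq (\<lambda>n. ennreal (F n x))" by (auto intro!: incseq_SucI ennreal_leI)
    then have "(\<lambda>n. ennreal (F n x)) \<longlonglongrightarrow> G x" unfolding G_def by (rule LIMSEQ_SUP)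
    then have "(\<lambda>n. ennreal (F n x)) \<longlonglongrightarrow> ennreal (f x)"
      using elim by (simp add: f_def less_top)
    then have "(\<lambda>n. F n x) \<longlonglongrightarrow> f x"
      using elim by (subst (asm) tendsto_ennreal_iff) (auto simp: f_def)
    then show ?case using elim by auto
  qed
  have "f \<in> fcarrier Y \<and> fnorm Y f \<le> C" by (rule fatou[OF F _ lim C]) auto
  moreover have "AE x in M. \<forall>n. F n x \<le> f x"
    using lim
  proof eventually_elim
    case (elim x)
    then have "incseq (\<lambda>n. F n x)" by (intro incseq_SucI) auto
    with elim show ?case by (auto intro: incseq_le)
  qed
  ultimately show ?thesis using lim by (intro that[of f]) (auto simp: f_def)
qed

text \<open>For sequences which are not monotone, pass to the infima of their tails.\<close>

lemma liminf_bound: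
  fixes F :: "nat \<Rightarrow> 'a \<Rightarrow> real"
  assumes F: "\<And>n. F n \<in> fcarrier Y" and nn: "\<And>n x. 0 \<le> F n x"
    and C: "\<And>n. fnorm Y (F n) \<le> C"
  obtains f where "f \<in> fcarrier Y" "fnorm Y f \<le> C" "\<And>x. 0 \<le> f x"
    "AE x in M. \<forall>c. eventually (\<lambda>n. c \<le> F n x) sequentially \<longrightarrow> c \<le> f x"
proof -
  note [measurable] = meas[OF F]
  define G where "G n x = (INF m\<in>{n..}. F m x)" for n x
  have bdd: "bdd_below ((\<lambda>m. F m x) ` S)" for x S using nn by (auto intro!: bdd_belowI[of _ 0])
  have [measurable]: "G n \<in> borel_measurable M" for n
    unfolding G_def[abs_def] by (intro borel_measurable_cINF bdd) auto
  have G0: "0 \<le> G n x" for n x unfolding G_def using nn by (intro cINF_greatest) auto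
  have GF: "G n x \<le> F n x" for n x unfolding G_def by (intro cINF_lower bdd) auto
  have Ginc: "G n x \<le> G (Suc n) x" for n x
    unfolding G_def by (intro cINF_superset_mono bdd) auto
  have G: "G n \<in> fcarrier Y \<and> fnorm Y (G n) \<le> fnorm Y (F n)" for n
    by (intro ideal F) (auto simp: G0 GF abs_of_nonneg nn)
  have GC: "fnorm Y (G n) \<le> C" for n using G C order_trans by blast
  obtain f where f: "f \<in> fcarrier Y" "fnorm Y f \<le> C"
      "AE x in M. \<forall>n. G n x \<le> f x" "\<And>x. 0 \<le> f x"
    by (rule increasing_limit[of G C]) (use G G0 Ginc GC in auto)
  have "AE x in M. \<forall>c. eventually (\<lambda>n. c \<le> F n x) sequentially \<longrightarrow> c \<le> f x"
    using f(3)
  proof eventually_elim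
    case (elim x)
    show ?case
    proof (intro allI impI)
      fix c assume "eventually (\<lambda>n. c \<le> F n x) sequentially"
      then obtain n where "\<And>m. m \<ge> n \<Longrightarrow> c \<le> F m x" by (auto simp: eventually_sequentially)
      then have "c \<le> G n x" unfolding G_def by (intro cINF_greatest) auto
      with elim show "c \<le> f x" using order_trans by blast
    qed
  qed
  with f show ?thesis using that by blast
qed

end

lemma powr_add_le_max:
  fixes a b q :: real
  assumes "0 < q" "0 \<le> a" "0 \<le> b"
  shows "(a + b) powr q \<le> 2 powr q * (a powr q + b powr q)"
proof -
  have "(a + b) powr q \<le> (2 * max a b) powr q" using assms by (intro powr_mono2) auto
  also have "\<dots> = 2 powr q * max a b powr q" by (simp add: powr_mult)
  also have "max a b powr q \<le> a powr q + b powr q" by (auto simp: max_def)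
  finally show ?thesis by simp
qed

text \<open>
  The \<open>q\<close>-convexity of \<open>X\<close> is the triangle inequality of \<open>X\<^sup>q\<close>, written in terms of the
  \<open>q\<close>-th roots.
\<close>

lemma banach_fspace_concavification:
  assumes "sigma_finite_measure M" and X: "qbfs M X" and conv: "q_convex q X" and q: "0 < q"
  shows "banach_fspace M (concavification M X q)"
proof -
  interpret sigma_finite_measure M by fact
  let ?Y = "concavification M X q"
  note QN = X[unfolded qbfs_def, THEN conjunct1, unfolded quasi_normed_fspace_def]
  note Xm = QN[THEN conjunct1, THEN subsetD]
  note QN1 = QN[THEN conjunct2, THEN conjunct2]
  note Xadd = QN1[THEN conjunct1, rule_format]
  note QN2 = QN1[THEN conjunct2]
  note Xscale1 = QN2[THEN conjunct1, rule_format]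
  note QN3 = QN2[THEN conjunct2]
  note Xnn = QN3[THEN conjunct1, rule_format]
  note QN4 = QN3[THEN conjunct2]
  note X0 = QN4[THEN conjunct1, rule_format, THEN iffD1]
  note Xscale = Xscale1 QN4[THEN conjunct2, THEN conjunct1, rule_format]
  note Xrest = X[unfolded qbfs_def, THEN conjunct2]
  note Xideal = Xrest[THEN conjunct1, rule_format]
  note Xfatou' = Xrest[THEN conjunct2, THEN conjunct1, rule_format]
  note Xsat = Xrest[THEN conjunct2, THEN conjunct2, rule_format]
  have Xfatou: "f \<in> fcarrier X \<and> fnorm X f = (SUP n. fnorm X (F n))"
    if "f \<in> borel_measurable M" "\<And>n::nat. F n \<in> fcarrier X"
      "AE x in M. (\<forall>n. 0 \<le> F n x \<and> F n x \<le> F (Suc n) x) \<and> (\<lambda>n. F n x) \<longlonglongrightarrow> f x"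
      "bdd_above (range (\<lambda>n. fnorm X (F n)))" for f F
    by (rule Xfatou') (use that in auto)
  have mem: "f \<in> fcarrier ?Y \<longleftrightarrow> f \<in> borel_measurable M \<and> (\<lambda>x. \<bar>f x\<bar> powr (1/q)) \<in> fcarrier X" for f
    by (simp add: concavification_def)
  have nrm: "fnorm ?Y f = fnorm X (\<lambda>x. \<bar>f x\<bar> powr (1/q)) powr q" for f
    by (simp add: concavification_def)
  have scale: "(\<lambda>x. \<bar>c * f x\<bar> powr (1/q)) = (\<lambda>x. \<bar>c\<bar> powr (1/q) * \<bar>f x\<bar> powr (1/q))" for c and f :: "'a \<Rightarrow> real"
    by (simp add: abs_mult powr_mult)
  have idealY: "g \<in> fcarrier ?Y \<and> fnorm ?Y g \<le> fnorm ?Y f"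
    if f: "f \<in> fcarrier ?Y" and g[measurable]: "g \<in> borel_measurable M" and le: "AE x in M. \<bar>g x\<bar> \<le> \<bar>f x\<bar>" for f g
  proof -
    have *: "(\<lambda>x. \<bar>g x\<bar> powr (1/q)) \<in> fcarrier X \<and>
      fnorm X (\<lambda>x. \<bar>g x\<bar> powr (1/q)) \<le> fnorm X (\<lambda>x. \<bar>f x\<bar> powr (1/q))"
    proof (rule Xideal)
      show "AE x in M. \<bar>\<bar>g x\<bar> powr (1/q)\<bar> \<le> \<bar>\<bar>f x\<bar> powr (1/q)\<bar>"
        using le by eventually_elim (use q in \<open>auto intro!: powr_mono2\<close>)
    qed (use f in \<open>auto simp: mem\<close>)
    then show ?thesis using g Xnn q by (auto simp: mem nrm intro!: powr_mono2)
  qed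
  have addY: "(\<lambda>x. f x + g x) \<in> fcarrier ?Y \<and> fnorm ?Y (\<lambda>x. f x + g x) \<le> fnorm ?Y f + fnorm ?Y g"
    if f: "f \<in> fcarrier ?Y" and g: "g \<in> fcarrier ?Y" for f g
  proof -
    let ?u = "\<lambda>x. \<bar>f x\<bar> powr (1/q)" and ?v = "\<lambda>x. \<bar>g x\<bar> powr (1/q)"
    have [measurable]: "f \<in> borel_measurable M" "g \<in> borel_measurable M" using f g by (auto simp: mem)
    have u: "?u \<in> fcarrier X" and v: "?v \<in> fcarrier X" using f g by (auto simp: mem)
    have eq: "(\<lambda>x. (\<bar>?u x\<bar> powr q + \<bar>?v x\<bar> powr q) powr (1 / q)) = (\<lambda>x. (\<bar>f x\<bar> + \<bar>g x\<bar>) powr (1/q))"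
      using q by (simp add: powr_powr)
    have w: "(\<lambda>x. (\<bar>f x\<bar> + \<bar>g x\<bar>) powr (1/q)) \<in> fcarrier X"
      using powr_add_le_max[of "1/q"] q
      by (intro conjunct1[OF Xideal[OF Xscale(1)[OF Xadd[OF u v], of "2 powr (1/q)"]]]) auto
    have le: "fnorm X (\<lambda>x. (\<bar>f x\<bar> + \<bar>g x\<bar>) powr (1/q)) \<le> (fnorm X ?u powr q + fnorm X ?v powr q) powr (1/q)"
      using conv[unfolded q_convex_def, rule_format, OF u v] unfolding eq .
    have *: "(\<lambda>x. \<bar>f x + g x\<bar> powr (1/q)) \<in> fcarrier X \<and>
      fnorm X (\<lambda>x. \<bar>f x + g x\<bar> powr (1/q)) \<le> fnorm X (\<lambda>x. (\<bar>f x\<bar> + \<bar>g x\<bar>) powr (1/q))"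
      using q by (intro Xideal w) (auto intro!: powr_mono2)
    then have "fnorm X (\<lambda>x. \<bar>f x + g x\<bar> powr (1/q)) powr q
       \<le> ((fnorm X ?u powr q + fnorm X ?v powr q) powr (1/q)) powr q"
      using le q Xnn by (intro powr_mono2) auto
    also have "\<dots> = fnorm X ?u powr q + fnorm X ?v powr q" using q by (simp add: powr_powr)
    finally show ?thesis using * by (auto simp: mem nrm)
  qed
  show ?thesis
  proof unfold_locales
    fix f assume f: "f \<in> fcarrier ?Y"
    then show "f \<in> borel_measurable M" by (simp add: mem)
    show "0 \<le> fnorm ?Y f" by (simp add: nrm)
    show "AE x in M. f x = 0" if "fnorm ?Y f = 0"
      using X0[of "\<lambda>x. \<bar>f x\<bar> powr (1/q)"] f that by (auto simp: mem nrm)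
    fix c
    show "(\<lambda>x. c * f x) \<in> fcarrier ?Y"
      using f Xscale(1)[of "\<lambda>x. \<bar>f x\<bar> powr (1/q)" "\<bar>c\<bar> powr (1/q)"] 
      unfolding mem scale by auto
    show "fnorm ?Y (\<lambda>x. c * f x) = \<bar>c\<bar> * fnorm ?Y f"
      unfolding nrm scale using f q by (simp add: mem Xscale powr_mult powr_powr)
  next
    show "(\<lambda>x. 0) \<in> fcarrier ?Y" 
      using X q by (auto simp: mem qbfs_def quasi_normed_fspace_def)
  next
    fix A assume "A \<in> sets M" "0 < emeasure M A"
    from Xsat[OF this] obtain B
      where B: "B \<in> sets M" "B \<subseteq> A" "0 < emeasure M B" "indicator B \<in> fcarrier X"
      by auto
    have "(\<lambda>x. \<bar>indicator B x\<bar> powr (1/q)) = (indicator B :: 'a \<Rightarrow> real)"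
      using q by (auto simp: indicator_def fun_eq_iff)
    then have "indicator B \<in> fcarrier ?Y" using B by (simp add: mem)
    then show "\<exists>B\<in>sets M. B \<subseteq> A \<and> 0 < emeasure M B \<and> indicator B \<in> fcarrier ?Y" using B by blast
  next
    fix F :: "nat \<Rightarrow> 'a \<Rightarrow> real" and f C
    assume F: "\<And>n. F n \<in> fcarrier ?Y" and f[measurable]: "f \<in> borel_measurable M"
      and inc: "AE x in M. (\<forall>n. 0 \<le> F n x \<and> F n x \<le> F (Suc n) x) \<and> (\<lambda>n. F n x) \<longlonglongrightarrow> f x"
      and C: "\<And>n. fnorm ?Y (F n) \<le> C"
    define G where "G n x = \<bar>F n x\<bar> powr (1/q)" for n x
    have G: "G n \<in> fcarrier X" for n using F[of n] by (simp add: mem G_def[abs_def])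
    have C0: "0 \<le> C" using C[of 0] by (auto simp: nrm intro: order_trans[OF powr_ge_zero])
    have bd: "fnorm X (G n) \<le> C powr (1/q)" for n
    proof -
      have "(fnorm X (G n) powr q) powr (1/q) \<le> C powr (1/q)"
        using C[of n] q by (intro powr_mono2) (auto simp: nrm G_def[abs_def])
      then show ?thesis using q Xnn[OF G] by (simp add: powr_powr)
    qed
    have "(\<lambda>x. \<bar>f x\<bar> powr (1/q)) \<in> fcarrier X \<and> fnorm X (\<lambda>x. \<bar>f x\<bar> powr (1/q)) = (SUP n. fnorm X (G n))"
    proof (rule Xfatou)
      show "AE x in M. (\<forall>n. 0 \<le> G n x \<and> G n x \<le> G (Suc n) x) \<and> (\<lambda>n. G n x) \<longlonglongrightarrow> \<bar>f x\<bar> powr (1/q)"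
        using inc 
      proof eventually_elim
        case (elim x)
        have "G n x \<le> G (Suc n) x" for n
          using elim q by (auto simp: G_def intro!: powr_mono2)
        moreover have "(\<lambda>n. G n x) \<longlonglongrightarrow> \<bar>f x\<bar> powr (1/q)"
          unfolding G_def using elim q
          by (intro tendsto_powr2 tendsto_intros) auto
        ultimately show ?case by (auto simp: G_def)
      qed
      show "bdd_above (range (\<lambda>n. fnorm X (G n)))" by (rule bdd_aboveI2[OF bd])
    qed (use G in auto)
    moreover have "(SUP n. fnorm X (G n)) \<le> C powr (1/q)" using bd by (intro cSUP_least) auto
    ultimately have m: "f \<in> fcarrier ?Y" and le: "fnorm X (\<lambda>x. \<bar>f x\<bar> powr (1/q)) \<le> C powr (1/q)"
      by (auto simp: mem)
    have "fnorm ?Y f \<le> (C powr (1/q)) powr q"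
      unfolding nrm using le m q by (intro powr_mono2 Xnn) (auto simp: mem)
    then show "f \<in> fcarrier ?Y \<and> fnorm ?Y f \<le> C" using m q C0 by (simp add: powr_powr)
  qed (use addY idealY in blast)+
qed

section \<open>The Koethe dual\<close>

context banach_fspace
begin

abbreviation dual :: "'a fspace" where "dual \<equiv> koethe_dual M Y"

lemma dual_meas: "g \<in> fcarrier dual \<Longrightarrow> g \<in> borel_measurable M"
  by (simp add: koethe_dual_def)

lemma nn_integral_mult_null:
  assumes "f \<in> fcarrier Y" "fnorm Y f = 0"
  shows "(\<integral>\<^sup>+ x. ennreal \<bar>f x * g x\<bar> \<partial>M) = 0"
proof -
  have "(\<integral>\<^sup>+ x. ennreal \<bar>f x * g x\<bar> \<partial>M) = (\<integral>\<^sup>+ x. 0 \<partial>M)"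
    using norm_eq_0D[OF assms] by (intro nn_integral_cong_AE) (auto elim: eventually_mono)
  then show ?thesis by simp
qed

text \<open>
  Gliding hump: if integration against \<open>\<bar>g\<bar>\<close> were unbounded on the unit ball, then functions
  of norm \<open>2\<^sup>-\<^sup>n\<close> whose integrals against \<open>\<bar>g\<bar>\<close> are at least \<open>2\<^sup>n\<close> could be summed
  in \<open>Y\<close>, and the sum would not be integrable against \<open>g\<close>.
\<close>

lemma dual_bounded:
  assumes g: "g \<in> fcarrier dual"
  shows "\<exists>C\<ge>0. \<forall>f\<in>fcarrier Y. (\<integral>\<^sup>+ x. ennreal \<bar>f x * g x\<bar> \<partial>M) \<le> ennreal (C * fnorm Y f)"
proof (rule ccontr)
  assume *: "\<not> ?thesis"
  note [measurable] = dual_meas[OF g]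
  have "\<exists>f\<in>fcarrier Y. ennreal (4 ^ n * fnorm Y f) < (\<integral>\<^sup>+ x. ennreal \<bar>f x * g x\<bar> \<partial>M)" for n :: nat
    using * by (auto simp: not_le dest: spec[of _ "4 ^ n"])
  then obtain \<phi> where \<phi>: "\<And>n. \<phi> n \<in> fcarrier Y"
    and big: "\<And>n. ennreal (4 ^ n * fnorm Y (\<phi> n)) < (\<integral>\<^sup>+ x. ennreal \<bar>\<phi> n x * g x\<bar> \<partial>M)"
    by metis
  note [measurable] = meas[OF \<phi>]
  have pos: "0 < fnorm Y (\<phi> n)" for n
    using big[of n] nn_integral_mult_null[OF \<phi>, of n g] norm_nonneg[OF \<phi>, of n]
    by (cases "fnorm Y (\<phi> n) = 0") auto
  define a where "a n = 1 / (2 ^ n * fnorm Y (\<phi> n))" for n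
  have a: "0 < a n" for n using pos by (simp add: a_def)
  define h where "h n x = a n * \<bar>\<phi> n x\<bar>" for n x
  have h: "h n \<in> fcarrier Y" for n
    using scale_mem[OF abs_mem(1)[OF \<phi>], of "a n"] by (simp add: h_def[abs_def])
  have hn: "fnorm Y (h n) = 1 / 2 ^ n" for n
    using norm_scale[OF abs_mem(1)[OF \<phi>], of "a n"] abs_mem(2)[OF \<phi>] pos[of n]
    by (simp add: h_def[abs_def] a_def)
  have h0: "0 \<le> h n x" for n x using a by (simp add: h_def less_imp_le)
  define S where "S n x = (\<Sum>k<n. h k x)" for n x
  have S: "S n \<in> fcarrier Y \<and> fnorm Y (S n) \<le> (\<Sum>k<n. 1 / 2 ^ k)" for n
  proof (induction n)
    case 0
    then show ?case using norm_null[of "\<lambda>x. 0"] by (simp add: S_def[abs_def])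
  next
    case (Suc n)
    have "S (Suc n) = (\<lambda>x. S n x + h n x)" by (auto simp: S_def)
    then show ?case using Suc add_mem[of "S n" "h n"] norm_triangle[of "S n" "h n"] h hn by auto
  qed
  have "fnorm Y (S n) \<le> 2" for n
  proof -
    have "(\<Sum>k<n. 1 / 2 ^ k) \<le> (2::real)" using sum_gp_strict[of "1/2::real" n] by (simp add: power_divide)
    then show ?thesis using S[of n] by linarith
  qed
  then obtain f where f: "f \<in> fcarrier Y" "AE x in M. \<forall>n. S n x \<le> f x" "\<And>x. 0 \<le> f x"
    using S h0 by (elim increasing_limit[of S 2, rotated 2]) (auto simp: S_def intro!: sum_nonneg)
  note [measurable] = meas[OF f(1)]
  have hf: "AE x in M. h n x \<le> f x" for n
    using f(2)
  proof eventually_elim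
    case (elim x)
    then have "S (Suc n) x \<le> f x" by blast
    moreover have "0 \<le> S n x" by (simp add: S_def sum_nonneg h0)
    ultimately show ?case by (simp add: S_def)
  qed
  have "integrable M (\<lambda>x. f x * g x)" using g f(1) by (simp add: koethe_dual_def)
  then obtain R where R: "0 \<le> R" "(\<integral>\<^sup>+ x. ennreal \<bar>f x * g x\<bar> \<partial>M) = ennreal R"
    by (auto simp: integrable_iff_bounded less_top[symmetric] elim!: ennreal_cases)
  have "2 ^ n \<le> R" for n :: nat
  proof -
    have "ennreal (2 ^ n) = ennreal (a n) * ennreal (4 ^ n * fnorm Y (\<phi> n))"
      using pos[of n] a[of n] 
      by (simp add: ennreal_mult[symmetric] a_def power_mult_distrib[symmetric] field_simps)
    also have "\<dots> \<le> ennreal (a n) * (\<integral>\<^sup>+ x. ennreal \<bar>\<phi> n x * g x\<bar> \<partial>M)"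
      using big[of n] by (intro mult_left_mono) auto
    also have "\<dots> = (\<integral>\<^sup>+ x. ennreal \<bar>h n x * g x\<bar> \<partial>M)"
      using a[of n] by (subst nn_integral_cmult[symmetric])
        (auto simp: h_def abs_mult ennreal_mult[symmetric] mult.assoc intro!: nn_integral_cong)
    also have "\<dots> \<le> (\<integral>\<^sup>+ x. ennreal \<bar>f x * g x\<bar> \<partial>M)"
      using hf[of n] h0 f(3) by (intro nn_integral_mono_AE)
         (auto simp: abs_mult abs_of_nonneg intro!: ennreal_leI mult_right_mono elim!: eventually_mono)
    finally show ?thesis using R by simp
  qed
  moreover obtain n :: nat where "R < 2 ^ n" using real_arch_pow[of 2 R] by auto
  ultimately show False by (auto simp: not_le[symmetric])
qed

text \<open>
  By \<open>dual_bounded\<close> the supremum that defines the norm of the dual is finite, hence it is not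
  lost in the conversion to a real number. Together with its converse \<open>koethe_dualI\<close> this
  inequality characterises the norm of \<open>g\<close> as the least admissible constant.
\<close>

lemma koethe_hoelder:
  assumes f: "f \<in> fcarrier Y" and g: "g \<in> fcarrier dual"
  shows "(\<integral>\<^sup>+ x. ennreal \<bar>f x * g x\<bar> \<partial>M) \<le> ennreal (fnorm Y f * fnorm dual g)"
proof -
  note [measurable] = dual_meas[OF g] meas[OF f]
  define S where "S = (SUP f\<in>{f \<in> fcarrier Y. fnorm Y f = 1}. \<integral>\<^sup>+ x. ennreal \<bar>f x * g x\<bar> \<partial>M)"
  obtain C where "\<And>f. f\<in>fcarrier Y \<Longrightarrow> (\<integral>\<^sup>+ x. ennreal \<bar>f x * g x\<bar> \<partial>M) \<le> ennreal (C * fnorm Y f)"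
    using dual_bounded[OF g] by auto
  then have "S \<le> ennreal C" unfolding S_def by (intro SUP_least) force
  then have S: "S = ennreal (fnorm dual g)"
    by (simp add: koethe_dual_def S_def[symmetric] neq_top_trans less_top[symmetric])
       (metis ennreal_enn2real ennreal_neq_top neq_top_trans less_top)
  show ?thesis
  proof (cases "fnorm Y f = 0")
    case True
    then show ?thesis using nn_integral_mult_null[OF f True] by simp
  next
    case False
    define n where "n = fnorm Y f"
    have n: "0 < n" using False norm_nonneg[OF f] by (simp add: n_def)
    define e where "e x = inverse n * f x" for x
    have e: "e \<in> fcarrier Y" "fnorm Y e = 1"
      using scale_mem[OF f, of "inverse n"] norm_scale[OF f, of "inverse n"] n
      by (auto simp: e_def[abs_def] n_def[symmetric])
    have "(\<integral>\<^sup>+ x. ennreal \<bar>f x * g x\<bar> \<partial>M) = (\<integral>\<^sup>+ x. ennreal n * ennreal \<bar>e x * g x\<bar> \<partial>M)"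
      using n by (intro nn_integral_cong) (auto simp: e_def ennreal_mult[symmetric] abs_mult field_simps)
    also have "\<dots> = ennreal n * (\<integral>\<^sup>+ x. ennreal \<bar>e x * g x\<bar> \<partial>M)"
    proof (rule nn_integral_cmult)
      note [measurable] = meas[OF e(1)]
      show "(\<lambda>x. ennreal \<bar>e x * g x\<bar>) \<in> borel_measurable M" by measurable
    qed
    also have "\<dots> \<le> ennreal n * S"
      unfolding S_def using e by (intro mult_left_mono SUP_upper) auto
    finally show ?thesis using n unfolding S n_def
      by (simp add: ennreal_mult' koethe_dual_def)
  qed
qed

lemma koethe_dualI:
  assumes [measurable]: "g \<in> borel_measurable M" and C: "0 \<le> C"
    and le: "\<And>f. f \<in> fcarrier Y \<Longrightarrow> (\<integral>\<^sup>+ x. ennreal \<bar>f x * g x\<bar> \<partial>M) \<le> ennreal (C * fnorm Y f)"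
  shows "g \<in> fcarrier dual \<and> fnorm dual g \<le> C"
proof
  have "integrable M (\<lambda>x. f x * g x)" if f: "f \<in> fcarrier Y" for f
    using meas[OF f] le[OF f] 
    by (auto simp: integrable_iff_bounded intro: le_less_trans[OF _ ennreal_less_top])
  then show "g \<in> fcarrier dual" by (simp add: koethe_dual_def)
  have "(SUP f\<in>{f \<in> fcarrier Y. fnorm Y f = 1}. \<integral>\<^sup>+ x. ennreal \<bar>f x * g x\<bar> \<partial>M) \<le> ennreal C"
    using le by (intro SUP_least) force
  then show "fnorm dual g \<le> C"
    using C by (simp add: koethe_dual_def enn2real_leI)
qed

text \<open>This identity plays the role of the parallelogram law in the next proof.\<close>

lemma exp_midpoint:
  fixes a b :: real
  shows "(exp (- a / 2) - exp (- b / 2))\<^sup>2 = exp (- a) + exp (- b) - 2 * exp (- ((a + b) / 2))"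
proof -
  have "exp (- a) = (exp (- a / 2))\<^sup>2" "exp (- b) = (exp (- b / 2))\<^sup>2"
    by (simp_all add: power2_eq_square exp_add[symmetric])
  moreover have "exp (- ((a + b) / 2)) = exp (- a / 2) * exp (- b / 2)"
    by (simp add: exp_add[symmetric] add_divide_distrib)
  ultimately show ?thesis by (simp add: power2_diff)
qed

text \<open>
  For a minimising sequence \<open>v n\<close> of \<open>J\<close> over the nonnegative part \<open>D\<close> of the unit ball, the
  midpoint of two elements lies in \<open>D\<close> again, so \<open>exp_midpoint\<close> shows that the functions
  \<open>exp (- v n / 2)\<close> form a Cauchy sequence in \<open>L\<^sup>2(A)\<close>. As \<open>A\<close> has finite measure and the convergence
  may be made fast, they converge almost everywhere on \<open>A\<close>, and by the Fatou property \<open>D\<close>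
  contains a function that lies above the limit of the \<open>v n\<close>.
\<close>

lemma minimiser:
  fixes A :: "'a set" and J :: "('a \<Rightarrow> real) \<Rightarrow> real" and D :: "('a \<Rightarrow> real) set"
  assumes A[measurable]: "A \<in> sets M" "emeasure M A < \<infinity>"
  defines "J \<equiv> \<lambda>f. \<integral> x. indicator A x * exp (- f x) \<partial>M"
    and "D \<equiv> {f \<in> fcarrier Y. fnorm Y f \<le> 1 \<and> (\<forall>x. 0 \<le> f x)}"
  obtains u where "u \<in> D" "\<And>f. f \<in> D \<Longrightarrow> J u \<le> J f"
proof -
  have intA: "integrable M (indicator A :: 'a \<Rightarrow> real)" using A by (simp add: integrable_indicator_iff)
  have Dm: "f \<in> borel_measurable M" if "f \<in> D" for f using that meas by (auto simp: D_def)
  have int: "integrable M (\<lambda>x. indicator A x * exp (- f x))" if "f \<in> D" for f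
    using Dm[OF that] that
    by (intro Bochner_Integration.integrable_bound[OF intA]) (auto simp: D_def split: split_indicator)
  have J0: "0 \<le> J f" for f unfolding J_def by (intro integral_nonneg_AE) auto
  have bdd: "bdd_below (J ` D)" using J0 by (auto intro!: bdd_belowI[of _ 0])
  have D0: "(\<lambda>x. 0) \<in> D" using zero_mem norm_null[of "\<lambda>x. 0"] by (simp add: D_def)
  define j where "j = (INF f\<in>D. J f)"
  have j: "j \<le> J f" if "f \<in> D" for f unfolding j_def using that by (intro cINF_lower bdd)
  have "\<exists>f\<in>D. J f < j + 1 / 16 ^ n" for n :: nat
    using D0 cINF_less_iff[OF _ bdd, of "j + 1 / 16 ^ n"] by (auto simp: j_def[symmetric])
  then obtain v where v: "\<And>n. v n \<in> D" and Jv: "\<And>n. J (v n) < j + 1 / 16 ^ n" by metis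
  note [measurable] = Dm[OF v]
  define h where "h n x = exp (- v n x / 2)" for n x
  have [measurable]: "h n \<in> borel_measurable M" for n unfolding h_def[abs_def] by measurable
  have v0: "0 \<le> v n x" for n x using v[of n] by (simp add: D_def)
  have h01: "0 < h n x" "h n x \<le> 1" for n x using v0[of n x] by (auto simp: h_def)
  have h2: "(h n x)\<^sup>2 = exp (- v n x)" for n x
    by (simp add: h_def power2_eq_square exp_add[symmetric])
  define d where "d n x = \<bar>h (Suc n) x - h n x\<bar>" for n x
  have [measurable]: "d n \<in> borel_measurable M" for n unfolding d_def[abs_def] by measurable
  have d1: "d n x \<le> 1" "0 \<le> d n x" for n x using h01[of n x] h01[of "Suc n" x] by (auto simp: d_def)
  have intd: "integrable M (\<lambda>x. indicator A x * (d n x)\<^sup>2)" "integrable M (\<lambda>x. indicator A x * d n x)" for n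
    using d1 by (auto intro!: Bochner_Integration.integrable_bound[OF intA] AE_I2 power_le_one split: split_indicator)
  have L2: "(\<integral> x. indicator A x * (d n x)\<^sup>2 \<partial>M) \<le> 2 / 16 ^ n" for n
  proof -
    define m where "m x = (1/2) * v n x + (1/2) * v (Suc n) x" for x
    have vv: "v n \<in> fcarrier Y" "v (Suc n) \<in> fcarrier Y" "fnorm Y (v n) \<le> 1" "fnorm Y (v (Suc n)) \<le> 1"
      using v by (auto simp: D_def)
    have "fnorm Y (\<lambda>x. (1/2) * v n x) \<le> 1/2" "fnorm Y (\<lambda>x. (1/2) * v (Suc n) x) \<le> 1/2"
      unfolding norm_scale[OF vv(1)] norm_scale[OF vv(2)] using vv(3,4) by simp_all
    then have "fnorm Y m \<le> 1"
      using norm_triangle[OF scale_mem[OF vv(1), of "1/2"] scale_mem[OF vv(2), of "1/2"]]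
      unfolding m_def[abs_def] by linarith
    moreover have "m \<in> fcarrier Y" unfolding m_def[abs_def] by (intro add_mem scale_mem vv)
    ultimately have m: "m \<in> D" using v0[of n] v0[of "Suc n"] by (simp add: D_def m_def)
    have "indicator A x * (d n x)\<^sup>2 = indicator A x * exp (- v n x) + indicator A x * exp (- v (Suc n) x)
       - 2 * (indicator A x * exp (- m x))" for x
    proof -
      have mx: "(v (Suc n) x + v n x) / 2 = m x" by (simp add: m_def add_divide_distrib)
      show ?thesis
        using exp_midpoint[of "v (Suc n) x" "v n x", unfolded mx]
        by (simp add: d_def h_def split: split_indicator)
    qed
    then have "(\<integral> x. indicator A x * (d n x)\<^sup>2 \<partial>M) = J (v n) + J (v (Suc n)) - 2 * J m"
      using int[OF v] int[OF m] unfolding J_def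
      by (simp add: Bochner_Integration.integral_diff Bochner_Integration.integral_add)
    also have "\<dots> \<le> 1 / 16 ^ n + 1 / 16 ^ Suc n" using Jv[of n] Jv[of "Suc n"] j[OF m] by linarith
    also have "\<dots> \<le> 2 / 16 ^ n" by (simp add: field_simps)
    finally show ?thesis .
  qed
  have L1: "(\<integral> x. indicator A x * d n x \<partial>M) \<le> (measure M A + 2) * (1/4) ^ n" for n
  proof -
    have "(\<integral> x. indicator A x * d n x \<partial>M)
       \<le> (\<integral> x. (1/4)^n * indicator A x + 4 ^ n * (indicator A x * (d n x)\<^sup>2) \<partial>M)"
    proof (rule integral_mono)
      fix x
      \<comment> \<open>the factor \<open>2 ^ n\<close> balances the decay of the \<open>L\<^sup>2\<close> norms against the measure of \<open>A\<close>\<close>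
      have "0 \<le> (1/2 ^ n - 2 ^ n * d n x)\<^sup>2" by simp
      also have "\<dots> = (1/4) ^ n + 4 ^ n * (d n x)\<^sup>2 - 2 * d n x"
        by (simp add: power2_diff power_mult_distrib power_divide power_mult[symmetric] mult.commute[of _ 2])
           (simp add: power_mult)
      finally show "indicator A x * d n x \<le> (1/4)^n * indicator A x + 4 ^ n * (indicator A x * (d n x)\<^sup>2)"
        using d1[of n x] by (auto split: split_indicator)
    qed (use intd intA in auto)
    also have "\<dots> = (1/4)^n * measure M A + 4 ^ n * (\<integral> x. indicator A x * (d n x)\<^sup>2 \<partial>M)"
      using intd intA A by simp
    also have "\<dots> \<le> (1/4)^n * measure M A + 4 ^ n * (2 / 16 ^ n)"
      by (intro add_left_mono mult_left_mono L2) auto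
    also have "4 ^ n * (2 / 16 ^ n) = 2 * (1 / 4 :: real) ^ n"
    proof -
      have "(16::real) ^ n = 4 ^ n * 4 ^ n" by (simp add: power_mult_distrib[symmetric])
      then show ?thesis by (simp add: power_divide)
    qed
    finally show ?thesis by (simp add: algebra_simps)
  qed
  have "AE x in M. (\<Sum>n. ennreal (indicator A x * d n x)) \<noteq> \<infinity>"
  proof (rule nn_integral_PInf_AE)
    have "(\<integral>\<^sup>+ x. (\<Sum>n. ennreal (indicator A x * d n x)) \<partial>M) = (\<Sum>n. \<integral>\<^sup>+ x. ennreal (indicator A x * d n x) \<partial>M)"
      by (intro nn_integral_suminf) auto
    also have "\<dots> = (\<Sum>n. ennreal (\<integral> x. indicator A x * d n x \<partial>M))"
      using intd d1 by (intro suminf_cong nn_integral_eq_integral) auto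
    also have "\<dots> \<le> (\<Sum>n. ennreal ((measure M A + 2) * (1/4) ^ n))"
      by (intro suminf_le ennreal_leI L1) auto
    also have "\<dots> = ennreal (\<Sum>n. (measure M A + 2) * (1/4) ^ n)"
      by (intro suminf_ennreal2 summable_mult summable_geometric) auto
    also have "\<dots> < \<infinity>" by simp
    finally show "(\<integral>\<^sup>+ x. (\<Sum>n. ennreal (indicator A x * d n x)) \<partial>M) \<noteq> \<infinity>" by simp
  qed measurable
  then have conv: "AE x in M. x \<in> A \<longrightarrow> (\<lambda>n. h n x) \<longlonglongrightarrow> lim (\<lambda>n. h n x)"
  proof eventually_elim
    case (elim x)
    show ?case
    proof
      assume "x \<in> A"
      with elim have "(\<Sum>n. ennreal (d n x)) \<noteq> top" by simp
      then have "summable (\<lambda>n. d n x)" using d1(2) by (rule summable_suminf_not_top[rotated])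
      then have "summable (\<lambda>n. h (Suc n) x - h n x)"
        unfolding d_def by (rule summable_rabs_cancel)
      then have "convergent (\<lambda>n. \<Sum>k<n. h (Suc k) x - h k x)" by (simp add: summable_iff_convergent)
      then have "convergent (\<lambda>n. (h n x - h 0 x) + h 0 x)"
        by (intro convergent_add convergent_const) (simp add: sum_lessThan_telescope[of "\<lambda>n. h n x"])
      then show "(\<lambda>n. h n x) \<longlonglongrightarrow> lim (\<lambda>n. h n x)" by (simp add: convergent_LIMSEQ_iff)
    qed
  qed
  define l where "l x = lim (\<lambda>n. h n x)" for x
  have [measurable]: "l \<in> borel_measurable M" unfolding l_def[abs_def] by measurable
  have "(\<lambda>n. J (v n)) \<longlonglongrightarrow> (\<integral> x. indicator A x * (l x)\<^sup>2 \<partial>M)"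
    unfolding J_def h2[symmetric]
  proof (rule integral_dominated_convergence[where w="indicator A"])
    show "AE x in M. (\<lambda>n. indicator A x * (h n x)\<^sup>2) \<longlonglongrightarrow> indicator A x * (l x)\<^sup>2"
      using conv by eventually_elim (auto simp: l_def intro!: tendsto_intros split: split_indicator)
    show "AE x in M. norm (indicator A x * (h n x)\<^sup>2) \<le> indicator A x" for n
      using power_le_one[OF less_imp_le[OF h01(1)] h01(2), of n _ 2]
      by (auto intro!: AE_I2 split: split_indicator)
  qed (use intA in auto)
  moreover have "(\<lambda>n. J (v n)) \<longlonglongrightarrow> j"
  proof (rule tendsto_sandwich[OF _ _ tendsto_const])
    show "(\<lambda>n. j + 1 / 16 ^ n) \<longlonglongrightarrow> j"
      using tendsto_add[OF tendsto_const[of j] LIMSEQ_power_zero[of "1/16::real"]]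
      by (simp add: power_divide)
    show "\<forall>\<^sub>F n in sequentially. J (v n) \<le> j + 1 / 16 ^ n" by (intro always_eventually allI less_imp_le Jv)
  qed (use j v in auto)
  ultimately have jl: "(\<integral> x. indicator A x * (l x)\<^sup>2 \<partial>M) = j" by (rule LIMSEQ_unique)
  obtain u where u: "u \<in> fcarrier Y" "fnorm Y u \<le> 1" "\<And>x. 0 \<le> u x"
    and uc: "AE x in M. \<forall>c. eventually (\<lambda>n. c \<le> v n x) sequentially \<longrightarrow> c \<le> u x"
    by (rule liminf_bound[of v 1]) (use v in \<open>auto simp: D_def\<close>)
  have uD: "u \<in> D" using u by (simp add: D_def)
  have ul: "AE x in M. x \<in> A \<longrightarrow> exp (- u x) \<le> (l x)\<^sup>2 \<and> 0 \<le> l x \<and> l x \<le> 1"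
    using conv uc
  proof eventually_elim
    case (elim x)
    show ?case
    proof
      assume x: "x \<in> A"
      have lim: "(\<lambda>n. h n x) \<longlonglongrightarrow> l x" using elim x by (simp add: l_def)
      have l0: "0 \<le> l x" using h01 by (intro LIMSEQ_le_const[OF lim]) (auto intro: less_imp_le)
      have l1: "l x \<le> 1" using h01 by (intro LIMSEQ_le_const2[OF lim]) auto
      have "exp (- u x / 2) \<le> l x"
      proof (rule field_le_epsilon)
        fix e :: real assume e: "0 < e"
        have "eventually (\<lambda>n. h n x < l x + e) sequentially" using lim e by (intro order_tendstoD) auto
        then have "eventually (\<lambda>n. - 2 * ln (l x + e) \<le> v n x) sequentially"
        proof eventually_elim
          case (elim n)
          then have "ln (h n x) \<le> ln (l x + e)" using h01[of n x] by (subst ln_le_cancel_iff) auto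
          then show ?case by (simp add: h_def)
        qed
        with elim(2) have "- 2 * ln (l x + e) \<le> u x" by blast
        then have "- u x / 2 \<le> ln (l x + e)" by simp
        then have "exp (- u x / 2) \<le> exp (ln (l x + e))" by (simp only: exp_le_cancel_iff)
        then show "exp (- u x / 2) \<le> l x + e" using l0 e by simp
      qed
      then have "(exp (- u x / 2))\<^sup>2 \<le> (l x)\<^sup>2" by (intro power_mono) auto
      then show "exp (- u x) \<le> (l x)\<^sup>2 \<and> 0 \<le> l x \<and> l x \<le> 1"
        using l0 l1 by (simp add: power2_eq_square exp_add[symmetric])
    qed
  qed
  have "J u \<le> (\<integral> x. indicator A x * (l x)\<^sup>2 \<partial>M)"
    unfolding J_def
  proof (rule integral_mono_AE[OF int[OF uD]])
    show "integrable M (\<lambda>x. indicator A x * (l x)\<^sup>2)"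
    proof (rule Bochner_Integration.integrable_bound[OF intA])
      show "AE x in M. norm (indicator A x * (l x)\<^sup>2) \<le> norm (indicator A x :: real)"
        using ul by eventually_elim (auto intro!: power_le_one split: split_indicator)
    qed measurable
    show "AE x in M. indicator A x * exp (- u x) \<le> indicator A x * (l x)\<^sup>2"
      using ul by eventually_elim (auto split: split_indicator)
  qed
  then show ?thesis using jl j uD by (intro that[of u]) force+
qed

text \<open>
  Let \<open>u\<close> minimise \<open>J f = \<integral>\<^sub>A exp (- f)\<close> over the nonnegative part of the unit ball. The
  derivative of \<open>J\<close> at \<open>u\<close> in the direction of \<open>f - u\<close> is nonnegative, which says that
  \<open>\<integral>\<^sub>A f * exp (- u) \<le> \<integral>\<^sub>A u * exp (- u)\<close>. Since \<open>t * exp (- t) \<le> 1\<close>, the integrals of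
  \<open>f * exp (- u)\<close> over \<open>A\<close> are bounded as \<open>f\<close> runs through the unit ball, so that
  \<open>exp (- u)\<close>, restricted to \<open>A\<close>, belongs to the dual. Differentiation under the integral is
  replaced by Fatou's lemma; this only worsens the constant.
\<close>

lemma dual_positive_on:
  assumes A[measurable]: "A \<in> sets M" "emeasure M A < \<infinity>"
  obtains g where "g \<in> fcarrier dual" "\<And>x. x \<in> A \<Longrightarrow> 0 < g x"
proof -
  obtain u where u: "u \<in> fcarrier Y" "fnorm Y u \<le> 1" "\<And>x. 0 \<le> u x"
    and min: "\<And>f. f \<in> fcarrier Y \<Longrightarrow> fnorm Y f \<le> 1 \<Longrightarrow> (\<And>x. 0 \<le> f x) \<Longrightarrow>
      (\<integral> x. indicator A x * exp (- u x) \<partial>M) \<le> (\<integral> x. indicator A x * exp (- f x) \<partial>M)"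
    by (rule minimiser[OF A]) auto
  note [measurable] = meas[OF u(1)]
  have intA: "integrable M (indicator A :: 'a \<Rightarrow> real)" using A by (simp add: integrable_indicator_iff)
  define g where "g x = indicator A x * exp (- u x)" for x
  have [measurable]: "g \<in> borel_measurable M" unfolding g_def[abs_def] by measurable
  have unit: "(\<integral>\<^sup>+ x. ennreal (f x * g x) \<partial>M) \<le> ennreal (2 * measure M A)"
    if f: "f \<in> fcarrier Y" "fnorm Y f \<le> 1" "\<And>x. 0 \<le> f x" for f
  proof -
    note [measurable] = meas[OF f(1)]
    define t where "t n = 1 / (real n + 2)" for n
    have t: "0 < t n" "t n \<le> 1 / 2" for n by (auto simp: t_def field_simps)
    define w where "w n x = (1 - t n) * u x + t n * f x" for n x
    have w0: "0 \<le> w n x" for n x using t[of n] u(3) f(3) by (simp add: w_def)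
    have w: "w n \<in> fcarrier Y" for n
      unfolding w_def[abs_def] by (intro add_mem scale_mem u f)
    note [measurable] = meas[OF w]
    have w1: "fnorm Y (w n) \<le> 1" for n
    proof -
      have "fnorm Y (w n) \<le> (1 - t n) * fnorm Y u + t n * fnorm Y f"
        using norm_triangle[OF scale_mem[OF u(1), of "1 - t n"] scale_mem[OF f(1), of "t n"]] t[of n]
        by (simp add: w_def[abs_def] norm_scale u f)
      also have "\<dots> \<le> (1 - t n) * 1 + t n * 1" using t[of n] u(2) f(2) by (intro add_mono mult_left_mono) auto
      finally show ?thesis by simp
    qed
    have int: "integrable M (\<lambda>x. indicator A x * exp (- w n x))" "integrable M (\<lambda>x. indicator A x * exp (- u x))" for n
      using w0 u(3) by (auto intro!: Bochner_Integration.integrable_bound[OF intA] split: split_indicator)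
    define p where "p n x = exp (- w n x) * (f x - u x)" for n x
    \<comment> \<open>\<open>p n\<close> lies below the rate at which \<open>exp (- u)\<close> decreases in the step from \<open>u\<close> to \<open>w n\<close>\<close>
    have up: "t n * p n x \<le> exp (- u x) - exp (- w n x)" for n x
    proof -
      have "exp (- w n x) * (1 + t n * (f x - u x)) \<le> exp (- w n x) * exp (t n * (f x - u x))"
        using exp_ge_add_one_self by (intro mult_left_mono) auto
      also have "\<dots> = exp (- u x)" by (simp add: exp_add[symmetric] w_def algebra_simps)
      finally show ?thesis by (simp add: p_def algebra_simps)
    qed
    \<comment> \<open>a lower bound uniform in \<open>n\<close>, as Fatou's lemma needs; it holds because \<open>t n \<le> 1 / 2\<close>\<close>
    have low: "- 2 \<le> p n x" for n x
    proof -
      have "t n * u x \<le> (1/2) * u x" using t[of n] u(3) by (intro mult_right_mono) auto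
      moreover have "0 \<le> t n * f x" using t[of n] f(3) by simp
      ultimately have "u x / 2 \<le> w n x" by (simp add: w_def algebra_simps)
      then have "exp (- w n x) * u x \<le> exp (- (u x / 2)) * u x" using u(3) by (intro mult_right_mono) auto
      also have "\<dots> \<le> exp (- (u x / 2)) * (2 * exp (u x / 2))"
        using exp_ge_add_one_self[of "u x / 2"] by (intro mult_left_mono) (linarith, simp)
      also have "\<dots> = 2" by (simp add: exp_add[symmetric])
      finally have "exp (- w n x) * u x \<le> 2" .
      moreover have "0 \<le> exp (- w n x) * f x" using f(3) by simp
      ultimately show ?thesis by (simp add: p_def algebra_simps)
    qed
    have bound: "(\<integral>\<^sup>+ x. ennreal (indicator A x * (p n x + 2)) \<partial>M) \<le> ennreal (2 * measure M A)" for n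
    proof -
      have "(\<integral>\<^sup>+ x. ennreal (indicator A x * (p n x + 2)) \<partial>M)
        \<le> (\<integral>\<^sup>+ x. ennreal (indicator A x * ((exp (- u x) - exp (- w n x)) / t n + 2)) \<partial>M)"
        using up[of n] t[of n]
        by (intro nn_integral_mono ennreal_leI mult_left_mono) (auto simp: field_simps)
      also have "\<dots> = ennreal (\<integral> x. indicator A x * ((exp (- u x) - exp (- w n x)) / t n + 2) \<partial>M)"
      proof (rule nn_integral_eq_integral)
        have "integrable M (\<lambda>x. (indicator A x * exp (- u x) - indicator A x * exp (- w n x)) / t n + 2 * indicator A x)"
          using int intA by auto
        then show "integrable M (\<lambda>x. indicator A x * ((exp (- u x) - exp (- w n x)) / t n + 2))"
          by (simp add: algebra_simps diff_divide_distrib)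
        show "AE x in M. 0 \<le> indicator A x * ((exp (- u x) - exp (- w n x)) / t n + 2)"
        proof (intro AE_I2 mult_nonneg_nonneg)
          fix x
          have "p n x \<le> (exp (- u x) - exp (- w n x)) / t n" using up[of n x] t[of n] by (simp add: field_simps)
          then show "0 \<le> (exp (- u x) - exp (- w n x)) / t n + 2" using low[of n x] by linarith
        qed auto
      qed
      also have "(\<integral> x. indicator A x * ((exp (- u x) - exp (- w n x)) / t n + 2) \<partial>M)
        = (\<integral> x. (indicator A x * exp (- u x) - indicator A x * exp (- w n x)) / t n + 2 * indicator A x \<partial>M)"
        by (intro Bochner_Integration.integral_cong) (auto split: split_indicator)
      also have "\<dots> = ((\<integral> x. indicator A x * exp (- u x) \<partial>M) - (\<integral> x. indicator A x * exp (- w n x) \<partial>M)) / t n + 2 * measure M A"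
        using int intA A by simp
      also have "\<dots> \<le> 2 * measure M A"
        using min[OF w w1 w0] t[of n] by (simp add: divide_nonpos_pos)
      finally show ?thesis by (simp add: ennreal_leI)
    qed
    have t_lim: "t \<longlonglongrightarrow> 0" unfolding t_def by real_asymp
    have "f x * g x \<le> indicator A x * (exp (- u x) * (f x - u x) + 2)" for x
    proof -
      have "exp (- u x) * u x \<le> exp (- u x) * exp (u x)"
        using exp_ge_add_one_self[of "u x"] by (intro mult_left_mono) (linarith, simp)
      then have "exp (- u x) * u x \<le> 1" by (simp add: exp_add[symmetric])
      then show ?thesis by (auto simp: g_def algebra_simps split: split_indicator)
    qed
    then have "(\<integral>\<^sup>+ x. ennreal (f x * g x) \<partial>M)
        \<le> (\<integral>\<^sup>+ x. ennreal (indicator A x * (exp (- u x) * (f x - u x) + 2)) \<partial>M)"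
      by (intro nn_integral_mono ennreal_leI)
    also have "\<dots> = (\<integral>\<^sup>+ x. liminf (\<lambda>n. ennreal (indicator A x * (p n x + 2))) \<partial>M)"
    proof (rule nn_integral_cong)
      fix x
      have "(\<lambda>n. w n x) \<longlonglongrightarrow> (1 - 0) * u x + 0 * f x"
        unfolding w_def by (intro tendsto_intros t_lim)
      then have "(\<lambda>n. indicator A x * (p n x + 2)) \<longlonglongrightarrow> indicator A x * (exp (- u x) * (f x - u x) + 2)"
        unfolding p_def by (intro tendsto_intros) auto
      then have "(\<lambda>n. ennreal (indicator A x * (p n x + 2)))
          \<longlonglongrightarrow> ennreal (indicator A x * (exp (- u x) * (f x - u x) + 2))"
        by (rule tendsto_ennrealI)
      then show "ennreal (indicator A x * (exp (- u x) * (f x - u x) + 2))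
         = liminf (\<lambda>n. ennreal (indicator A x * (p n x + 2)))"
        by (simp add: lim_imp_Liminf)
    qed
    also have "\<dots> \<le> liminf (\<lambda>n. \<integral>\<^sup>+ x. ennreal (indicator A x * (p n x + 2)) \<partial>M)"
      unfolding p_def by (intro nn_integral_liminf) measurable
    also have "\<dots> \<le> ennreal (2 * measure M A)"
      by (intro Liminf_le) (auto simp: bound)
    finally show ?thesis .
  qed
  have "g \<in> fcarrier dual \<and> fnorm dual g \<le> 2 * measure M A"
  proof (rule koethe_dualI)
    fix f assume f: "f \<in> fcarrier Y"
    note [measurable] = meas[OF f]
    show "(\<integral>\<^sup>+ x. ennreal \<bar>f x * g x\<bar> \<partial>M) \<le> ennreal (2 * measure M A * fnorm Y f)"
    proof (cases "fnorm Y f = 0")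
      case True
      then show ?thesis using nn_integral_mult_null[OF f True] by simp
    next
      case False
      define n where "n = fnorm Y f"
      have n: "0 < n" using False norm_nonneg[OF f] by (simp add: n_def)
      define e where "e x = inverse n * \<bar>f x\<bar>" for x
      have e: "e \<in> fcarrier Y" "fnorm Y e \<le> 1" "\<And>x. 0 \<le> e x"
        using scale_mem[OF abs_mem(1)[OF f], of "inverse n"] norm_scale[OF abs_mem(1)[OF f], of "inverse n"]
          n abs_mem(2)[OF f] by (auto simp: e_def[abs_def] n_def[symmetric])
      have "(\<integral>\<^sup>+ x. ennreal \<bar>f x * g x\<bar> \<partial>M) = (\<integral>\<^sup>+ x. ennreal n * ennreal (e x * g x) \<partial>M)"
        using n by (intro nn_integral_cong)
          (auto simp: e_def ennreal_mult'[symmetric] abs_mult g_def field_simps split: split_indicator)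
      also have "\<dots> = ennreal n * (\<integral>\<^sup>+ x. ennreal (e x * g x) \<partial>M)"
        by (rule nn_integral_cmult) (simp add: e_def[abs_def])
      also have "\<dots> \<le> ennreal n * ennreal (2 * measure M A)"
        by (intro mult_left_mono unit e) auto
      also have "\<dots> = ennreal (2 * measure M A * fnorm Y f)"
        using n by (simp add: ennreal_mult[symmetric] n_def[symmetric] mult.commute)
      finally show ?thesis .
    qed
  qed auto
  then show ?thesis by (intro that[of g]) (auto simp: g_def)
qed

text \<open>
  A function of the dual that is positive on a given set dominates multiples of the indicators of
  its superlevel sets.
\<close>

lemma dual_saturated:
  assumes A: "A \<in> sets M" "0 < emeasure M A"
  shows "\<exists>B\<in>sets M. B \<subseteq> A \<and> 0 < emeasure M B \<and> indicator B \<in> fcarrier dual"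
proof -
  obtain S where S: "range S \<subseteq> sets M" "(\<Union>i::nat. S i) = space M" "\<And>i. emeasure M (S i) \<noteq> \<infinity>"
    by (rule sigma_finite) blast
  have "\<exists>i. 0 < emeasure M (A \<inter> S i)"
  proof (rule ccontr)
    assume "\<not> ?thesis"
    then have "A \<inter> S i \<in> null_sets M" for i using A S by (auto simp: null_sets_def)
    then have "(\<Union>i. A \<inter> S i) \<in> null_sets M" by (intro null_sets_UN) auto
    moreover have "(\<Union>i. A \<inter> S i) = A" using S A sets.sets_into_space by fastforce
    ultimately show False using A by (auto simp: null_sets_def)
  qed
  then obtain i where i: "0 < emeasure M (A \<inter> S i)" by blast
  have Ai: "A \<inter> S i \<in> sets M" using A S by auto
  have "emeasure M (A \<inter> S i) \<le> emeasure M (S i)" using S by (intro emeasure_mono) auto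
  then have "emeasure M (A \<inter> S i) < \<infinity>" using S(3)[of i] by (auto simp: less_top top_unique)
  from dual_positive_on[OF Ai this] obtain g
    where g: "g \<in> fcarrier dual" "\<And>x. x \<in> A \<inter> S i \<Longrightarrow> 0 < g x" by blast
  note [measurable] = dual_meas[OF g(1)] Ai
  define B where "B n = {x \<in> A \<inter> S i. 1 / real (Suc n) < g x}" for n
  have B[measurable]: "B n \<in> sets M" for n
  proof -
    have "B n = {x \<in> space M. x \<in> A \<inter> S i \<and> 1 / real (Suc n) < g x}"
      using sets.sets_into_space[OF Ai] by (auto simp: B_def)
    also have "\<dots> \<in> sets M" by measurable
    finally show ?thesis .
  qed
  have "(\<Union>n. B n) = A \<inter> S i"
  proof (intro equalityI subsetI)
    fix x assume x: "x \<in> A \<inter> S i"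
    then obtain n where "1 / real (Suc n) < g x" using g(2) nat_approx_posE by blast
    with x show "x \<in> (\<Union>n. B n)" by (auto simp: B_def)
  qed (auto simp: B_def)
  then have "\<exists>n. 0 < emeasure M (B n)"
    using i null_sets_UN[of B] B by (metis not_gr_zero null_setsD1 null_setsI)
  then obtain n where n: "0 < emeasure M (B n)" by blast
  have "indicator (B n) \<in> fcarrier dual \<and> fnorm dual (indicator (B n)) \<le> real (Suc n) * fnorm dual g"
  proof (rule koethe_dualI)
    fix f assume f: "f \<in> fcarrier Y"
    note [measurable] = meas[OF f]
    have le: "\<bar>f x * indicator (B n) x\<bar> \<le> real (Suc n) * \<bar>f x * g x\<bar>" for x
    proof (cases "x \<in> B n")
      case True
      then have g0: "0 < g x" and "1 \<le> real (Suc n) * g x" using g(2) by (auto simp: B_def field_simps)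
      from this(2) have "\<bar>f x\<bar> * 1 \<le> \<bar>f x\<bar> * (real (Suc n) * g x)"
        by (rule mult_left_mono) simp
      also have "\<bar>f x\<bar> * (real (Suc n) * g x) = \<bar>f x\<bar> * (real (Suc n) * \<bar>g x\<bar>)" using g0 by simp
      also have "\<dots> = real (Suc n) * \<bar>f x * g x\<bar>" by (simp only: abs_mult mult_ac)
      finally show ?thesis using True by simp
    qed simp
    have "(\<integral>\<^sup>+ x. ennreal \<bar>f x * indicator (B n) x\<bar> \<partial>M) \<le> (\<integral>\<^sup>+ x. ennreal (real (Suc n)) * ennreal \<bar>f x * g x\<bar> \<partial>M)"
      using le by (intro nn_integral_mono) (simp add: ennreal_mult[symmetric] ennreal_leI del: of_nat_Suc)
    also have "\<dots> = ennreal (real (Suc n)) * (\<integral>\<^sup>+ x. ennreal \<bar>f x * g x\<bar> \<partial>M)"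
      by (rule nn_integral_cmult) measurable
    also have "\<dots> \<le> ennreal (real (Suc n)) * ennreal (fnorm Y f * fnorm dual g)"
      by (intro mult_left_mono koethe_hoelder f g) auto
    finally show "(\<integral>\<^sup>+ x. ennreal \<bar>f x * indicator (B n) x\<bar> \<partial>M) \<le> ennreal (real (Suc n) * fnorm dual g * fnorm Y f)"
      by (simp add: ennreal_mult'[symmetric] mult_ac del: of_nat_Suc)
  qed (auto simp: koethe_dual_def)
  then show ?thesis using n B by (intro bexI[of _ "B n"]) (auto simp: B_def)
qed

lemma banach_fspace_dual: "banach_fspace M dual"
proof -
  have nn: "0 \<le> fnorm dual g" for g by (simp add: koethe_dual_def)
  have scale: "(\<lambda>x. c * g x) \<in> fcarrier dual \<and> fnorm dual (\<lambda>x. c * g x) \<le> \<bar>c\<bar> * fnorm dual g"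
    if g: "g \<in> fcarrier dual" for c g
  proof (rule koethe_dualI)
    note [measurable] = dual_meas[OF g]
    fix f assume f: "f \<in> fcarrier Y"
    note [measurable] = meas[OF f]
    have "(\<integral>\<^sup>+ x. ennreal \<bar>f x * (c * g x)\<bar> \<partial>M) = (\<integral>\<^sup>+ x. ennreal \<bar>c\<bar> * ennreal \<bar>f x * g x\<bar> \<partial>M)"
      by (simp add: ennreal_mult[symmetric] abs_mult mult_ac)
    also have "\<dots> = ennreal \<bar>c\<bar> * (\<integral>\<^sup>+ x. ennreal \<bar>f x * g x\<bar> \<partial>M)" by (rule nn_integral_cmult) measurable
    also have "\<dots> \<le> ennreal \<bar>c\<bar> * ennreal (fnorm Y f * fnorm dual g)"
      by (intro mult_left_mono koethe_hoelder f g) auto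
    finally show "(\<integral>\<^sup>+ x. ennreal \<bar>f x * (c * g x)\<bar> \<partial>M) \<le> ennreal (\<bar>c\<bar> * fnorm dual g * fnorm Y f)"
      by (simp add: ennreal_mult'[symmetric] mult_ac)
  qed (use dual_meas[OF g] nn in auto)
  show ?thesis
  proof unfold_locales
    fix g assume g: "g \<in> fcarrier dual"
    note [measurable] = dual_meas[OF g]
    show "g \<in> borel_measurable M" by (rule dual_meas[OF g])
    show "0 \<le> fnorm dual g" by (rule nn)
    show "(\<lambda>x. c * g x) \<in> fcarrier dual" for c using scale[OF g] by blast
    show "fnorm dual (\<lambda>x. c * g x) = \<bar>c\<bar> * fnorm dual g" for c
    proof (cases "c = 0")
      case True
      then show ?thesis using scale[OF g, of 0] nn[of "\<lambda>x. 0"] by simp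
    next
      case False
      have cg: "(\<lambda>x. c * g x) \<in> fcarrier dual" using scale[OF g] by blast
      from scale[OF cg, of "inverse c"] False
      have "fnorm dual g \<le> \<bar>inverse c\<bar> * fnorm dual (\<lambda>x. c * g x)" by (simp add: mult.assoc[symmetric])
      then have "\<bar>c\<bar> * fnorm dual g \<le> fnorm dual (\<lambda>x. c * g x)" using False by (simp add: field_simps)
      with scale[OF g, of c] show ?thesis by (intro antisym) auto
    qed
    show "AE x in M. g x = 0" if 0: "fnorm dual g = 0"
    proof (rule ccontr)
      assume *: "\<not> ?thesis"
      define A where "A = {x \<in> space M. g x \<noteq> 0}"
      have A: "A \<in> sets M" unfolding A_def by measurable
      have "0 < emeasure M A"
        using emeasure_pos_if_not_AE[OF *] A by (simp add: A_def not_less)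
      from saturated[OF A this] obtain B where B: "B \<in> sets M" "B \<subseteq> A" "0 < emeasure M B"
        "indicator B \<in> fcarrier Y" by auto
      note [measurable] = B(1)
      have "(\<integral>\<^sup>+ x. ennreal \<bar>indicator B x * g x\<bar> \<partial>M) = 0"
        using koethe_hoelder[OF B(4) g] 0 by simp
      then have "AE x in M. ennreal \<bar>indicator B x * g x\<bar> = 0"
        by (subst (asm) nn_integral_0_iff_AE) auto
      then have "AE x in M. x \<notin> B"
        by eventually_elim (use B(2) in \<open>auto simp: A_def split: split_indicator_asm\<close>)
      then have "B \<in> null_sets M" using B(1) by (simp add: AE_iff_null_sets)
      with B(3) show False by (simp add: null_sets_def)
    qed
  next
    show "(\<lambda>x. 0) \<in> fcarrier dual" by (simp add: koethe_dual_def)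
  next
    fix g1 g2 assume g: "g1 \<in> fcarrier dual" "g2 \<in> fcarrier dual"
    note [measurable] = dual_meas[OF g(1)] dual_meas[OF g(2)]
    have "(\<lambda>x. g1 x + g2 x) \<in> fcarrier dual \<and> fnorm dual (\<lambda>x. g1 x + g2 x) \<le> fnorm dual g1 + fnorm dual g2"
    proof (rule koethe_dualI)
      fix f assume f: "f \<in> fcarrier Y"
      note [measurable] = meas[OF f]
      have "(\<integral>\<^sup>+ x. ennreal \<bar>f x * (g1 x + g2 x)\<bar> \<partial>M) \<le> (\<integral>\<^sup>+ x. ennreal \<bar>f x * g1 x\<bar> + ennreal \<bar>f x * g2 x\<bar> \<partial>M)"
        by (intro nn_integral_mono) (auto simp: ennreal_plus[symmetric] distrib_left simp del: ennreal_plus intro!: ennreal_leI)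
      also have "\<dots> = (\<integral>\<^sup>+ x. ennreal \<bar>f x * g1 x\<bar> \<partial>M) + (\<integral>\<^sup>+ x. ennreal \<bar>f x * g2 x\<bar> \<partial>M)"
        by (rule nn_integral_add) measurable
      also have "\<dots> \<le> ennreal (fnorm Y f * fnorm dual g1) + ennreal (fnorm Y f * fnorm dual g2)"
        by (intro add_mono koethe_hoelder f g)
      also have "\<dots> = ennreal ((fnorm dual g1 + fnorm dual g2) * fnorm Y f)"
        using norm_nonneg[OF f] nn by (simp add: ennreal_plus[symmetric] algebra_simps del: ennreal_plus)
      finally show "(\<integral>\<^sup>+ x. ennreal \<bar>f x * (g1 x + g2 x)\<bar> \<partial>M) \<le> ennreal ((fnorm dual g1 + fnorm dual g2) * fnorm Y f)" .
    qed (use nn in auto)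
    then show "(\<lambda>x. g1 x + g2 x) \<in> fcarrier dual" "fnorm dual (\<lambda>x. g1 x + g2 x) \<le> fnorm dual g1 + fnorm dual g2"
      by auto
  next
    fix g h assume g: "g \<in> fcarrier dual" and h: "h \<in> borel_measurable M" and le: "AE x in M. \<bar>h x\<bar> \<le> \<bar>g x\<bar>"
    show "h \<in> fcarrier dual \<and> fnorm dual h \<le> fnorm dual g"
    proof (rule koethe_dualI[OF h nn])
      fix f assume f: "f \<in> fcarrier Y"
      have "(\<integral>\<^sup>+ x. ennreal \<bar>f x * h x\<bar> \<partial>M) \<le> (\<integral>\<^sup>+ x. ennreal \<bar>f x * g x\<bar> \<partial>M)"
        using le by (intro nn_integral_mono_AE) (auto simp: abs_mult intro!: ennreal_leI mult_left_mono elim!: eventually_mono)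
      also have "\<dots> \<le> ennreal (fnorm Y f * fnorm dual g)" by (rule koethe_hoelder[OF f g])
      finally show "(\<integral>\<^sup>+ x. ennreal \<bar>f x * h x\<bar> \<partial>M) \<le> ennreal (fnorm dual g * fnorm Y f)"
        by (simp add: mult.commute)
    qed
  next
    fix G :: "nat \<Rightarrow> 'a \<Rightarrow> real" and g C
    assume G: "\<And>n. G n \<in> fcarrier dual" and g: "g \<in> borel_measurable M"
      and inc: "AE x in M. (\<forall>n. 0 \<le> G n x \<and> G n x \<le> G (Suc n) x) \<and> (\<lambda>n. G n x) \<longlonglongrightarrow> g x"
      and C: "\<And>n. fnorm dual (G n) \<le> C"
    show "g \<in> fcarrier dual \<and> fnorm dual g \<le> C"
    proof (rule koethe_dualI[OF g])
      show "0 \<le> C" using nn C order_trans by blast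
      fix f assume f: "f \<in> fcarrier Y"
      note [measurable] = meas[OF f] dual_meas[OF G] g
      have "(\<integral>\<^sup>+ x. ennreal \<bar>f x * g x\<bar> \<partial>M) = (\<integral>\<^sup>+ x. liminf (\<lambda>n. ennreal \<bar>f x * G n x\<bar>) \<partial>M)"
        using inc
      proof (intro nn_integral_cong_AE, eventually_elim)
        case (elim x)
        then have "(\<lambda>n. ennreal \<bar>f x * G n x\<bar>) \<longlonglongrightarrow> ennreal \<bar>f x * g x\<bar>"
          by (intro tendsto_ennrealI tendsto_intros) auto
        then show ?case by (intro lim_imp_Liminf[symmetric]) simp_all
      qed
      also have "\<dots> \<le> liminf (\<lambda>n. \<integral>\<^sup>+ x. ennreal \<bar>f x * G n x\<bar> \<partial>M)"
        by (intro nn_integral_liminf) measurable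
      also have "\<dots> \<le> ennreal (C * fnorm Y f)"
      proof (intro Liminf_le always_eventually allI)
        fix n
        have "(\<integral>\<^sup>+ x. ennreal \<bar>f x * G n x\<bar> \<partial>M) \<le> ennreal (fnorm Y f * fnorm dual (G n))"
          by (rule koethe_hoelder[OF f G])
        also have "\<dots> \<le> ennreal (C * fnorm Y f)"
          using C[of n] norm_nonneg[OF f] by (subst mult.commute) (intro ennreal_leI mult_right_mono)
        finally show "(\<integral>\<^sup>+ x. ennreal \<bar>f x * G n x\<bar> \<partial>M) \<le> ennreal (C * fnorm Y f)" .
      qed auto
      finally show "(\<integral>\<^sup>+ x. ennreal \<bar>f x * g x\<bar> \<partial>M) \<le> ennreal (C * fnorm Y f)" .
    qed
  qed (rule dual_saturated)
qed

end

section \<open>Averages and maximal operators\<close>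

lemma set_basisD:
  assumes "set_basis M \<E>" "E \<in> \<E>"
  shows "E \<in> sets M" "0 < emeasure M E" "emeasure M E < \<infinity>" "0 < measure M E"
  using assms by (auto simp: set_basis_def measure_def enn2real_positive_iff)

text \<open>
  Bounds of averages by real constants are bounds of integrals. In this form monotonicity and
  Fatou's lemma carry over to averages.
\<close>

lemma avg_le_iff:
  assumes E: "E \<in> sets M" "0 < measure M E" and r: "0 < r" and c: "0 \<le> c"
  shows "avg M (ennreal r) E f \<le> ennreal c \<longleftrightarrow>
    (\<integral>\<^sup>+ x. ennreal (\<bar>f x\<bar> powr r) * indicator E x \<partial>M) \<le> ennreal (c powr r * measure M E)"
proof -
  define I where "I = (\<integral>\<^sup>+ x. ennreal (\<bar>f x\<bar> powr r) * indicator E x \<partial>M)"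
  define m where "m = measure M E"
  have m: "0 < m" using E by (simp add: m_def)
  have "(\<integral>\<^sup>+ x. ennreal (\<bar>f x * indicator E x\<bar> powr r) \<partial>M) = I"
    unfolding I_def using r by (intro nn_integral_cong) (auto split: split_indicator)
  moreover have "inverse (ennreal r) = ennreal (1 / r)"
    using r by (simp add: inverse_ennreal inverse_eq_divide)
  ultimately have avg: "avg M (ennreal r) E f = ennreal (m powr (- (1/r))) * ennpowr I (1/r)"
    using r by (simp add: avg_def Lp_norm_def m_def)
  show ?thesis
  proof (cases I)
    case top
    then show ?thesis
      using m unfolding avg I_def[symmetric] m_def[symmetric]
      by (simp add: ennpowr_def ennreal_mult_top top_unique)
  next
    case (real i)
    have "avg M (ennreal r) E f \<le> ennreal c \<longleftrightarrow> m powr (- (1/r)) * i powr (1/r) \<le> c"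
      unfolding avg using real c by (simp add: ennpowr_def ennreal_mult[symmetric])
    also have "\<dots> \<longleftrightarrow> i powr (1/r) \<le> c * m powr (1/r)"
      using m by (simp add: powr_minus field_simps)
    also have "\<dots> \<longleftrightarrow> i \<le> c powr r * m"
    proof
      assume "i powr (1/r) \<le> c * m powr (1/r)"
      then have "(i powr (1/r)) powr r \<le> (c * m powr (1/r)) powr r" using r by (intro powr_mono2) auto
      then show "i \<le> c powr r * m" using r real m by (simp add: powr_powr powr_mult)
    next
      assume "i \<le> c powr r * m"
      then have "i powr (1/r) \<le> (c powr r * m) powr (1/r)" using r real by (intro powr_mono2) auto
      then show "i powr (1/r) \<le> c * m powr (1/r)" using r c by (simp add: powr_powr powr_mult)
    qed
    finally show ?thesis using real c m unfolding I_def[symmetric] m_def[symmetric] by simp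
  qed
qed

lemma avg_mono:
  assumes E: "E \<in> sets M" "0 < measure M E" and r: "0 < r" and le: "AE x in M. \<bar>f x\<bar> \<le> \<bar>g x\<bar>"
  shows "avg M (ennreal r) E f \<le> avg M (ennreal r) E g"
proof (cases "avg M (ennreal r) E g")
  case (real c)
  have "(\<integral>\<^sup>+ x. ennreal (\<bar>f x\<bar> powr r) * indicator E x \<partial>M) \<le> (\<integral>\<^sup>+ x. ennreal (\<bar>g x\<bar> powr r) * indicator E x \<partial>M)"
    using le
  proof (intro nn_integral_mono_AE, eventually_elim)
    case (elim x)
    then have "\<bar>f x\<bar> powr r \<le> \<bar>g x\<bar> powr r" using r by (intro powr_mono2) auto
    then show ?case by (intro mult_right_mono ennreal_leI) auto
  qed
  then show ?thesis using avg_le_iff[OF E r, where c=c and f=f] avg_le_iff[OF E r, where c=c and f=g] real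
    by auto
qed simp

lemma avg_tendsto_le:
  fixes F :: "nat \<Rightarrow> 'a \<Rightarrow> real"
  assumes E: "E \<in> sets M" "0 < measure M E" and r: "0 < r"
    and [measurable]: "\<And>n. F n \<in> borel_measurable M"
    and lim: "AE x in M. (\<lambda>n. F n x) \<longlonglongrightarrow> f x"
    and le: "\<And>n. avg M (ennreal r) E (F n) \<le> ennreal c" and c: "0 \<le> c"
  shows "avg M (ennreal r) E f \<le> ennreal c"
proof -
  note [measurable] = E(1)
  have "(\<integral>\<^sup>+ x. ennreal (\<bar>f x\<bar> powr r) * indicator E x \<partial>M)
     = (\<integral>\<^sup>+ x. liminf (\<lambda>n. ennreal (\<bar>F n x\<bar> powr r) * indicator E x) \<partial>M)"
    using lim
  proof (intro nn_integral_cong_AE, eventually_elim)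
    case (elim x)
    have "(\<lambda>n. \<bar>F n x\<bar> powr r) \<longlonglongrightarrow> \<bar>f x\<bar> powr r"
      using elim r by (intro tendsto_powr2 tendsto_intros) auto
    then have "(\<lambda>n. ennreal (\<bar>F n x\<bar> powr r) * indicator E x) \<longlonglongrightarrow> ennreal (\<bar>f x\<bar> powr r) * indicator E x"
      by (cases "x \<in> E") auto
    then show ?case by (intro lim_imp_Liminf[symmetric]) simp_all
  qed
  also have "\<dots> \<le> liminf (\<lambda>n. \<integral>\<^sup>+ x. ennreal (\<bar>F n x\<bar> powr r) * indicator E x \<partial>M)"
    by (intro nn_integral_liminf) measurable
  also have "\<dots> \<le> ennreal (c powr r * measure M E)"
    using le avg_le_iff[OF E r c] by (intro Liminf_le always_eventually) auto
  finally show ?thesis using avg_le_iff[OF E r c] by blast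
qed

lemma maximal_op_le_iff: "maximal_op M \<E> p f x \<le> y \<longleftrightarrow> (\<forall>E\<in>\<E>. x \<in> E \<longrightarrow> avg M p E f \<le> y)"
  by (auto simp: maximal_op_def SUP_le_iff split: split_indicator)

lemma maximal_op_mono:
  assumes "set_basis M \<E>" "0 < r" "AE x in M. \<bar>f x\<bar> \<le> \<bar>g x\<bar>"
  shows "maximal_op M \<E> (ennreal r) f x \<le> maximal_op M \<E> (ennreal r) g x"
  unfolding maximal_op_def using set_basisD[OF assms(1)] assms(2,3)
  by (intro SUP_subset_mono) (auto intro!: avg_mono split: split_indicator)

text \<open>
  Any two points lie in a common set of the basis, and countably many sets of the basis suffice to
  see this. Hence a function whose averages vanish over all sets containing one fixed point
  vanishes almost everywhere.
\<close>

lemma maximal_op_positive: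
  assumes \<E>: "set_basis M \<E>" and r: "0 < r" and [measurable]: "f \<in> borel_measurable M"
    and nz: "\<not> (AE x in M. f x = 0)" and x: "x \<in> space M"
  shows "0 < maximal_op M \<E> (ennreal r) f x"
proof (rule ccontr)
  assume "\<not> ?thesis"
  then have "maximal_op M \<E> (ennreal r) f x \<le> ennreal 0" by (simp add: not_gr_zero)
  then have avg0: "avg M (ennreal r) E f \<le> ennreal 0" if "E \<in> \<E>" "x \<in> E" for E
    using that unfolding maximal_op_le_iff by blast
  note common = \<E>[unfolded set_basis_def, THEN conjunct2, THEN conjunct2, THEN conjunct1]
  from \<E>[unfolded set_basis_def, THEN conjunct2, THEN conjunct2, THEN conjunct2]
  obtain \<E>' where \<E>': "\<E>' \<subseteq> \<E>" "countable \<E>'"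
    and cover: "\<forall>\<epsilon>>0. \<forall>E\<in>\<E>. \<exists>E'\<in>\<E>'. E \<subseteq> E' \<and> measure M E' \<le> (1 + \<epsilon>) * measure M E"
    by (elim exE conjE) (rule that)
  have "AE y in M. \<forall>E\<in>{E\<in>\<E>'. x \<in> E}. y \<in> E \<longrightarrow> f y = 0"
  proof (subst AE_ball_countable)
    show "countable {E\<in>\<E>'. x \<in> E}" using \<E>'(2) by auto
    show "\<forall>E\<in>{E\<in>\<E>'. x \<in> E}. AE y in M. y \<in> E \<longrightarrow> f y = 0"
    proof
      fix E assume "E \<in> {E\<in>\<E>'. x \<in> E}"
      then have E: "E \<in> \<E>" "x \<in> E" using \<E>' by auto
      note [measurable] = set_basisD(1)[OF \<E> E(1)]
      have "(\<integral>\<^sup>+ x. ennreal (\<bar>f x\<bar> powr r) * indicator E x \<partial>M) = 0"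
        using avg0[OF E] r set_basisD[OF \<E> E(1)] by (subst (asm) avg_le_iff) auto
      then have "AE y in M. ennreal (\<bar>f y\<bar> powr r) * indicator E y = 0"
        by (subst (asm) nn_integral_0_iff_AE) auto
      then show "AE y in M. y \<in> E \<longrightarrow> f y = 0"
        by eventually_elim (auto split: split_indicator_asm)
    qed
  qed
  moreover have "AE y in M. \<exists>E\<in>{E\<in>\<E>'. x \<in> E}. y \<in> E"
  proof (rule AE_I2)
    fix y assume "y \<in> space M"
    then obtain E where E: "E \<in> \<E>" "x \<in> E" "y \<in> E" using common x by blast
    moreover from cover[rule_format, of 1, OF _ E(1)] obtain E' where "E' \<in> \<E>'" "E \<subseteq> E'" by auto
    ultimately show "\<exists>E\<in>{E\<in>\<E>'. x \<in> E}. y \<in> E" by auto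
  qed
  ultimately have "AE y in M. f y = 0" by eventually_elim blast
  with nz show False by simp
qed

lemma op_norm_bound:
  assumes Y: "banach_fspace M Y" and bd: "op_bounded M Y Z T"
  shows "0 \<le> op_norm Y Z T"
    "f \<in> fcarrier Y \<Longrightarrow> fnorm Z (\<lambda>x. enn2real (T f x)) \<le> op_norm Y Z T * fnorm Y f"
proof -
  define S where "S = {C. 0 \<le> C \<and> (\<forall>f\<in>fcarrier Y. fnorm Z (\<lambda>x. enn2real (T f x)) \<le> C * fnorm Y f)}"
  have eq: "op_norm Y Z T = Inf S" by (simp add: op_norm_def S_def)
  obtain C where C: "C \<in> S" using bd by (auto simp: op_bounded_def S_def)
  show "0 \<le> op_norm Y Z T" unfolding eq using C by (intro cInf_greatest) (auto simp: S_def)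
  assume f: "f \<in> fcarrier Y"
  show "fnorm Z (\<lambda>x. enn2real (T f x)) \<le> op_norm Y Z T * fnorm Y f"
  proof (cases "fnorm Y f = 0")
    case True
    then show ?thesis using C f by (force simp: S_def)
  next
    case False
    then have pos: "0 < fnorm Y f" using banach_fspace.norm_nonneg[OF Y f] by simp
    have "fnorm Z (\<lambda>x. enn2real (T f x)) / fnorm Y f \<le> Inf S"
      using C f pos by (intro cInf_greatest) (auto simp: S_def divide_simps)
    then show ?thesis unfolding eq using pos by (simp add: divide_simps)
  qed
qed

section \<open>Positive isometries\<close>

locale positive_isometry = Y: banach_fspace M Y + Z: banach_fspace M Z
  for M :: "'a measure" and Y Z :: "'a fspace" +
  fixes L :: "('a \<Rightarrow> real) \<Rightarrow> 'a \<Rightarrow> real"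
  assumes iso: "positive_isometric_iso M Y Z L"
begin

lemma L_mem: "f \<in> fcarrier Y \<Longrightarrow> L f \<in> fcarrier Z"
  using iso by (simp add: positive_isometric_iso_def)

lemma L_add: "f \<in> fcarrier Y \<Longrightarrow> g \<in> fcarrier Y \<Longrightarrow> AE x in M. L (\<lambda>y. f y + g y) x = L f x + L g x"
  using iso by (simp add: positive_isometric_iso_def)

lemma L_scale: "f \<in> fcarrier Y \<Longrightarrow> AE x in M. L (\<lambda>y. c * f y) x = c * L f x"
  using iso by (simp add: positive_isometric_iso_def)

lemma L_surj: 
  assumes "g \<in> fcarrier Z" obtains f where "f \<in> fcarrier Y" "AE x in M. L f x = g x"
  using iso assms by (auto simp: positive_isometric_iso_def)

lemma L_norm: "f \<in> fcarrier Y \<Longrightarrow> fnorm Z (L f) = fnorm Y f"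
  using iso by (simp add: positive_isometric_iso_def)

lemma L_positive: "f \<in> fcarrier Y \<Longrightarrow> AE x in M. 0 \<le> f x \<Longrightarrow> AE x in M. 0 \<le> L f x"
  using iso by (simp add: positive_isometric_iso_def)

lemma L_diff:
  assumes "f \<in> fcarrier Y" "g \<in> fcarrier Y"
  shows "AE x in M. L (\<lambda>y. f y - g y) x = L f x - L g x"
  using L_add[OF assms(1) Y.scale_mem[OF assms(2), of "-1"]] L_scale[OF assms(2), of "-1"]
  by eventually_elim simp

lemma L_mono:
  assumes "f \<in> fcarrier Y" "g \<in> fcarrier Y" "AE x in M. f x \<le> g x"
  shows "AE x in M. L f x \<le> L g x"
proof -
  have "AE x in M. 0 \<le> L (\<lambda>x. g x - f x) x"
    using assms by (intro L_positive Y.diff_mem) (auto elim: eventually_mono)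
  with L_diff[OF assms(2,1)] show ?thesis by eventually_elim simp
qed

text \<open>
  For nonnegative \<open>L f\<close>, put \<open>v = L f\<^sup>-\<close>. Since a function has the same norm as its absolute
  value, \<open>f + t f\<^sup>- = f\<^sup>+ + (t - 1) f\<^sup>-\<close> and \<open>f - (t - 2) f\<^sup>- = f\<^sup>+ - (t - 1) f\<^sup>-\<close> have the
  same norm, so that \<open>\<parallel>L f + t v\<parallel> = \<parallel>L f - (t - 2) v\<parallel> \<le> \<parallel>L f + (t - 2) v\<parallel>\<close> for \<open>t \<ge> 2\<close>.
  Hence the norms of the multiples of \<open>v\<close> are bounded, and \<open>v\<close> vanishes.
\<close>

lemma L_reflects_nonneg:
  assumes f: "f \<in> fcarrier Y" and pos: "AE x in M. 0 \<le> L f x"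
  shows "AE x in M. 0 \<le> f x"
proof -
  note [measurable] = Y.meas[OF f]
  define m where "m x = max 0 (- f x)" for x
  have [measurable]: "m \<in> borel_measurable M" unfolding m_def[abs_def] by measurable
  have m: "m \<in> fcarrier Y"
    by (rule Y.ideal[THEN conjunct1, OF f]) (auto simp: m_def)
  define v where "v = L m"
  have v: "v \<in> fcarrier Z" unfolding v_def by (intro L_mem m)
  have v0: "AE x in M. 0 \<le> v x" unfolding v_def by (intro L_positive m) (auto simp: m_def)
  define g where "g = L f"
  have g: "g \<in> fcarrier Z" "AE x in M. 0 \<le> g x" unfolding g_def using pos f by (auto intro: L_mem)
  have mem: "(\<lambda>x. f x + c * m x) \<in> fcarrier Y" "(\<lambda>x. g x + c * v x) \<in> fcarrier Z" for c
    by (intro Y.add_mem Y.scale_mem Z.add_mem Z.scale_mem f m g v)+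
  have norm: "fnorm Z (\<lambda>x. g x + c * v x) = fnorm Y (\<lambda>x. f x + c * m x)" for c
  proof -
    have "AE x in M. g x + c * v x = L (\<lambda>x. f x + c * m x) x"
      using L_add[OF f Y.scale_mem[OF m, of c]] L_scale[OF m, of c]
      by eventually_elim (simp add: g_def v_def)
    from Z.mem_AE_cong(2)[OF L_mem[OF mem(1)] Z.meas[OF mem(2)] this] show ?thesis
      using L_norm[OF mem(1)] by simp
  qed
  have step: "fnorm Z (\<lambda>x. g x + t * v x) \<le> fnorm Z (\<lambda>x. g x + (t - 2) * v x)" if t: "2 \<le> t" for t
  proof -
    have "fnorm Z (\<lambda>x. g x + t * v x) = fnorm Y (\<lambda>x. \<bar>f x + t * m x\<bar>)"
      unfolding norm Y.abs_mem(2)[OF mem(1)] ..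
    also have "(\<lambda>x. \<bar>f x + t * m x\<bar>) = (\<lambda>x. \<bar>f x + (- (t - 2)) * m x\<bar>)"
      by (auto simp: m_def fun_eq_iff max_def abs_if algebra_simps)
    also have "fnorm Y \<dots> = fnorm Z (\<lambda>x. g x + (- (t - 2)) * v x)"
      unfolding norm Y.abs_mem(2)[OF mem(1)] ..
    also have "\<dots> \<le> fnorm Z (\<lambda>x. g x + (t - 2) * v x)"
    proof (rule Z.norm_mono[OF mem(2) mem(2)])
      show "AE x in M. \<bar>g x + - (t - 2) * v x\<bar> \<le> \<bar>g x + (t - 2) * v x\<bar>"
        using g(2) v0
      proof eventually_elim
        case (elim x)
        have "0 \<le> (t - 2) * v x" using t elim by simp
        moreover have "- (t - 2) * v x = - ((t - 2) * v x)" by (rule minus_mult_left[symmetric])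
        ultimately show ?case using elim by linarith
      qed
    qed
    finally show ?thesis .
  qed
  have bd: "fnorm Z (\<lambda>x. g x + (2 * real n) * v x) \<le> fnorm Z g" for n
  proof (induction n)
    case (Suc n)
    have "fnorm Z (\<lambda>x. g x + (2 * real (Suc n)) * v x) \<le> fnorm Z (\<lambda>x. g x + (2 * real (Suc n) - 2) * v x)"
      by (rule step) simp
    then show ?case using Suc by simp
  qed simp
  have le: "(2 * real n) * fnorm Z v \<le> fnorm Z g" for n
  proof -
    have "(2 * real n) * fnorm Z v = fnorm Z (\<lambda>x. (2 * real n) * v x)"
      using Z.norm_scale[OF v, of "2 * real n"] by simp
    also have "\<dots> \<le> fnorm Z (\<lambda>x. g x + (2 * real n) * v x)"
      using g(2) v0 by (intro Z.norm_mono mem Z.scale_mem v) (auto elim!: eventually_elim2)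
    also note bd
    finally show ?thesis .
  qed
  have "fnorm Z v = 0"
  proof (rule ccontr)
    assume "fnorm Z v \<noteq> 0"
    then have p: "0 < fnorm Z v" using Z.norm_nonneg[OF v] by simp
    obtain n where "fnorm Z g < real n * fnorm Z v" using reals_Archimedean3[OF p] by blast
    moreover have "real n * fnorm Z v \<le> (2 * real n) * fnorm Z v" using p by (simp add: mult_right_mono)
    ultimately show False using le[of n] by linarith
  qed
  then have "fnorm Y m = 0" using L_norm[OF m] by (simp add: v_def)
  from Y.norm_eq_0D[OF m this] show ?thesis by eventually_elim (auto simp: m_def max_def split: if_splits)
qed

lemma L_reflects_le:
  assumes "f \<in> fcarrier Y" "g \<in> fcarrier Y" "AE x in M. L f x \<le> L g x"
  shows "AE x in M. f x \<le> g x"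
proof -
  have "AE x in M. 0 \<le> L (\<lambda>x. g x - f x) x"
    using L_diff[OF assms(2,1)] assms(3) by eventually_elim simp
  from L_reflects_nonneg[OF Y.diff_mem[OF assms(2,1)] this] show ?thesis
    by eventually_elim simp
qed

lemma L_null:
  assumes "f \<in> fcarrier Y" "AE x in M. f x = 0"
  shows "AE x in M. L f x = 0"
  using assms Y.norm_null(2)[OF Y.meas] L_norm L_mem by (intro Z.norm_eq_0D) auto

text \<open>
  A positive surjective isometry preserves infima of nonnegative functions, because its inverse is
  positive. If \<open>w\<close> vanished on \<open>B\<close>, then \<open>L (indicator B)\<close> would be disjoint from \<open>L w\<close>.
\<close>

lemma positive_if_L_positive:
  assumes w: "w \<in> fcarrier Y" "AE x in M. 0 \<le> w x" and Lw: "AE x in M. 0 < L w x"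
  shows "AE x in M. 0 < w x"
proof (rule ccontr)
  assume *: "\<not> ?thesis"
  note [measurable] = Y.meas[OF w(1)] Z.meas[OF L_mem[OF w(1)]]
  define A where "A = {x \<in> space M. w x \<le> 0}"
  have A: "A \<in> sets M" unfolding A_def by measurable
  have "0 < emeasure M A"
    using emeasure_pos_if_not_AE[OF *] A by (simp add: A_def not_less)
  from Y.saturated[OF A this] obtain B where B: "B \<in> sets M" "B \<subseteq> A" "0 < emeasure M B"
    "indicator B \<in> fcarrier Y" by auto
  define v where "v = L (indicator B)"
  have v: "v \<in> fcarrier Z" "AE x in M. 0 \<le> v x"
    unfolding v_def using B by (auto intro!: L_mem L_positive)
  note [measurable] = Z.meas[OF v(1)]
  have "(\<lambda>x. min (v x) (L w x)) \<in> fcarrier Z"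
    using v(2) Lw by (intro conjunct1[OF Z.ideal[OF v(1)]]) (auto elim!: eventually_elim2)
  then obtain h where h: "h \<in> fcarrier Y" and Lh: "AE x in M. L h x = min (v x) (L w x)"
    using L_surj by blast
  have "AE x in M. 0 \<le> L h x" using Lh v(2) Lw by eventually_elim auto
  from L_reflects_nonneg[OF h this] have "AE x in M. 0 \<le> h x" .
  moreover have "AE x in M. L h x \<le> L (indicator B) x" using Lh by eventually_elim (simp add: v_def)
  from L_reflects_le[OF h B(4) this] have "AE x in M. h x \<le> indicator B x" .
  moreover have "AE x in M. L h x \<le> L w x" using Lh by eventually_elim simp
  from L_reflects_le[OF h w(1) this] have "AE x in M. h x \<le> w x" .
  ultimately have "AE x in M. h x = 0"
    using AE_space by eventually_elim (use B(2) in \<open>auto simp: A_def split: split_indicator_asm\<close>)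
  from L_null[OF h this] have "AE x in M. v x = 0" using Lh v(2) Lw by eventually_elim auto
  then have "fnorm Z v = 0" by (rule Z.norm_null(2)[OF Z.meas[OF v(1)]])
  then show False using Y.norm_indicator_pos[OF B(1,3,4)] L_norm[OF B(4)] by (simp add: v_def)
qed

end

lemma (in banach_fspace) positive_isometry_id: "positive_isometry M Y Y (\<lambda>f. f)"
  by unfold_locales (auto simp: positive_isometric_iso_def)

section \<open>The Rubio de Francia iteration\<close>

text \<open>
  Let \<open>K\<close> be the norm of the maximal operator. Start with \<open>\<bar>F\<bar>\<close> and iterate the map that sends
  \<open>w\<close> to the sum of \<open>\<bar>F\<bar>\<close> and the preimage under \<open>L\<close> of the maximal function of \<open>w\<close>, divided
  by \<open>2 * K\<close>. The second summand has at most half the norm of \<open>w\<close>, so all iterates have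
  norm at most \<open>2 * fnorm Y F\<close>; they increase because the inverse of \<open>L\<close> is positive. Averages
  pass to the limit, so the limit \<open>w\<close> is a fixed point up to an inequality: its maximal function
  is at most \<open>2 * K * L w\<close>. In particular \<open>L w\<close> is positive, and with it \<open>w\<close>.

  The norm \<open>K\<close> is positive: the maximal function of \<open>F\<close> is positive everywhere, so its norm
  does not vanish.
\<close>

lemma (in positive_isometry) rubio_de_francia:
  fixes \<E> r
  defines "T \<equiv> maximal_op M \<E> (ennreal r)"
  defines "K \<equiv> op_norm Y Z T"
  assumes \<E>: "set_basis M \<E>" and r: "0 < r" and bd: "op_bounded M Y Z T"
    and F: "F \<in> fcarrier Y" and nz: "\<not> (AE x in M. F x = 0)"
  obtains w where "w \<in> fcarrier Y" "fnorm Y w \<le> 2 * fnorm Y F" "AE x in M. \<bar>F x\<bar> \<le> w x" 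
    "AE x in M. 0 < w x" "AE x in M. 0 < L w x" "AE x in M. T w x \<le> ennreal (2 * K * L w x)" "0 < K"
proof -
  note K = op_norm_bound[OF Y.banach_fspace_axioms bd, folded K_def]
  have Tfin: "AE x in M. T f x < \<infinity>" and Tmem: "(\<lambda>x. enn2real (T f x)) \<in> fcarrier Z" if "f \<in> fcarrier Y" for f
    using bd that by (auto simp: op_bounded_def)
  have Tpos: "0 < T f x" if "f \<in> fcarrier Y" "\<not> (AE x in M. f x = 0)" "x \<in> space M" for f x
    unfolding T_def using that Y.meas by (intro maximal_op_positive[OF \<E> r]) auto
  have Kpos: "0 < K"
  proof (rule ccontr)
    assume "\<not> 0 < K"
    then have "fnorm Z (\<lambda>x. enn2real (T F x)) \<le> 0" using K(1) K(2)[OF F] by simp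
    then have "AE x in M. enn2real (T F x) = 0"
      using Z.norm_nonneg[OF Tmem[OF F]] by (intro Z.norm_eq_0D[OF Tmem[OF F]]) simp
    then have "AE x in M. False"
      using Tfin[OF F] AE_space
      by eventually_elim (use Tpos[OF F nz] in \<open>fastforce simp: enn2real_eq_0_iff\<close>)
    then have "AE x in M. F x = 0" by eventually_elim simp
    with nz show False ..
  qed
  have "\<forall>f\<in>fcarrier Y. \<exists>h\<in>fcarrier Y. AE x in M. L h x = enn2real (T f x)"
    using L_surj[OF Tmem] by metis
  then obtain H where H: "\<And>f. f \<in> fcarrier Y \<Longrightarrow> H f \<in> fcarrier Y"
    and LH: "\<And>f. f \<in> fcarrier Y \<Longrightarrow> AE x in M. L (H f) x = enn2real (T f x)" by metis
  have H0: "AE x in M. 0 \<le> H f x" if f: "f \<in> fcarrier Y" for f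
  proof (rule L_reflects_nonneg[OF H[OF f]])
    show "AE x in M. 0 \<le> L (H f) x" using LH[OF f] by eventually_elim simp
  qed
  have HK: "fnorm Y (H f) \<le> K * fnorm Y f" if f: "f \<in> fcarrier Y" for f
    using K(2)[OF f] L_norm[OF H[OF f]] LH[OF f]
      Z.mem_AE_cong(2)[OF Tmem[OF f] Z.meas[OF L_mem[OF H[OF f]]]] by simp
  define c where "c = 1 / (2 * K)"
  have c: "0 < c" using Kpos by (simp add: c_def)
  define w where "w = rec_nat (\<lambda>x. \<bar>F x\<bar>) (\<lambda>n f x. \<bar>F x\<bar> + c * H f x)"
  have w_0: "w 0 = (\<lambda>x. \<bar>F x\<bar>)" and w_Suc: "w (Suc n) = (\<lambda>x. \<bar>F x\<bar> + c * H (w n) x)" for n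
    by (simp_all add: w_def)
  have w: "w n \<in> fcarrier Y \<and> fnorm Y (w n) \<le> 2 * fnorm Y F" for n
  proof (induction n)
    case 0
    then show ?case using Y.abs_mem[OF F] Y.norm_nonneg[OF F] by (simp add: w_0)
  next
    case (Suc n)
    then have Hn: "H (w n) \<in> fcarrier Y" by (intro H) simp
    have "fnorm Y (w (Suc n)) \<le> fnorm Y F + c * fnorm Y (H (w n))"
      using Y.norm_triangle[OF Y.abs_mem(1)[OF F] Y.scale_mem[OF Hn, of c]] c
      by (simp add: w_Suc Y.abs_mem[OF F] Y.norm_scale[OF Hn])
    also have "c * fnorm Y (H (w n)) \<le> c * (K * (2 * fnorm Y F))"
      using HK[of "w n"] Suc c Kpos
      by (intro mult_left_mono) (auto intro: order_trans mult_left_mono less_imp_le)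
    also have "\<dots> = fnorm Y F" using Kpos by (simp add: c_def)
    finally show ?case unfolding w_Suc by (auto intro!: Y.add_mem Y.scale_mem Hn Y.abs_mem F)
  qed
  have wY: "w n \<in> fcarrier Y" for n using w by blast
  have w0: "AE x in M. 0 \<le> w n x" for n
  proof (cases n)
    case (Suc m)
    show ?thesis using H0[OF wY[of m]] c unfolding Suc w_Suc by (auto elim!: eventually_mono)
  qed (simp add: w_0)
  have inc: "AE x in M. w n x \<le> w (Suc n) x" for n
  proof (induction n)
    case 0
    show ?case using H0[OF wY[of 0]] c unfolding w_Suc by (auto simp: w_0 elim!: eventually_mono)
  next
    case (Suc n)
    have "AE x in M. \<bar>w n x\<bar> \<le> \<bar>w (Suc n) x\<bar>"
      using Suc w0[of n] w0[of "Suc n"] by eventually_elim simp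
    then have T: "T (w n) x \<le> T (w (Suc n)) x" for x
      unfolding T_def by (rule maximal_op_mono[OF \<E> r])
    have "AE x in M. L (H (w n)) x \<le> L (H (w (Suc n))) x"
      using LH[OF wY[of n]] LH[OF wY[of "Suc n"]] Tfin[OF wY[of "Suc n"]]
      by eventually_elim (simp add: T enn2real_mono)
    from L_reflects_le[OF H[OF wY] H[OF wY] this]
    have "AE x in M. H (w n) x \<le> H (w (Suc n)) x" .
    then show ?case unfolding w_Suc[of "Suc n"] w_Suc[of n] using c 
      by (auto elim!: eventually_mono)
  qed
  have mono: "AE x in M. \<forall>n. 0 \<le> w n x \<and> w n x \<le> w (Suc n) x"
    unfolding AE_all_countable using w0 inc by auto
  obtain u where u: "u \<in> fcarrier Y" "fnorm Y u \<le> 2 * fnorm Y F" "AE x in M. (\<lambda>n. w n x) \<longlonglongrightarrow> u x"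
    "AE x in M. \<forall>n. w n x \<le> u x" "\<And>x. 0 \<le> u x"
    by (rule Y.increasing_limit[OF wY mono]) (use w in auto)
  have LHu: "AE x in M. L (H (w n)) x \<le> 2 * K * L u x" for n
  proof -
    have "AE x in M. H (w n) x \<le> 2 * K * u x"
      using u(4)
    proof eventually_elim
      case (elim x)
      then have "w (Suc n) x \<le> u x" by blast
      then have "c * H (w n) x \<le> u x" unfolding w_Suc by linarith
      then show ?case using Kpos by (simp add: c_def field_simps)
    qed
    from L_mono[OF H[OF wY] Y.scale_mem[OF u(1)] this] L_scale[OF u(1), of "2 * K"] show ?thesis
      by eventually_elim simp
  qed
  have Lu0: "AE x in M. 0 \<le> L u x" using u by (intro L_positive) auto
  have Twn: "AE x in M. T (w n) x \<le> ennreal (2 * K * L u x)" for n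
    using LHu[of n] LH[OF wY[of n]] Tfin[OF wY[of n]]
  proof eventually_elim
    case (elim x)
    then have "T (w n) x = ennreal (enn2real (T (w n) x))" by simp
    also have "\<dots> \<le> ennreal (2 * K * L u x)" using elim by (intro ennreal_leI) simp
    finally show ?case .
  qed
  have "AE x in M. \<forall>n. T (w n) x \<le> ennreal (2 * K * L u x)"
    unfolding AE_all_countable using Twn by blast
  then have Tu: "AE x in M. T u x \<le> ennreal (2 * K * L u x)"
    using Lu0
  proof eventually_elim
    case (elim x)
    show ?case
      unfolding T_def maximal_op_le_iff
    proof (intro ballI impI)
      fix E assume E: "E \<in> \<E>" "x \<in> E"
      show "avg M (ennreal r) E u \<le> ennreal (2 * K * L u x)"
      proof (rule avg_tendsto_le[OF set_basisD(1,4)[OF \<E> E(1)] r Y.meas[OF wY] u(3)])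
        show "avg M (ennreal r) E (w n) \<le> ennreal (2 * K * L u x)" for n
          using elim(1) E unfolding T_def maximal_op_le_iff by blast
        show "0 \<le> 2 * K * L u x" using elim(2) Kpos by simp
      qed
    qed
  qed
  have Fu: "AE x in M. \<bar>F x\<bar> \<le> u x" using u(4) by eventually_elim (metis w_0)
  have unz: "\<not> (AE x in M. u x = 0)"
  proof
    assume "AE x in M. u x = 0"
    with Fu have "AE x in M. F x = 0" by eventually_elim auto
    with nz show False ..
  qed
  have Lpos: "AE x in M. 0 < L u x"
    using Tu AE_space
  proof eventually_elim
    case (elim x)
    then have "0 < ennreal (2 * K * L u x)" using Tpos[OF u(1) unz] less_le_trans by blast
    then show ?case using Kpos by (simp add: zero_less_mult_iff)
  qed
  have "AE x in M. 0 < u x" by (rule positive_if_L_positive[OF u(1) AE_I2[OF u(5)] Lpos])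
  from that[OF u(1,2) Fu this Lpos Tu Kpos] show ?thesis .
qed

section \<open>Weights\<close>

lemma enn2real_inverse_eq_0_iff: "0 < p \<Longrightarrow> enn2real (inverse p) = 0 \<longleftrightarrow> p = \<infinity>"
  by (cases p) (auto simp: enn2real_eq_0_iff)

lemma Lp_norm_null:
  assumes [measurable]: "f \<in> borel_measurable M" and f: "AE x in M. f x = 0"
  shows "Lp_norm M p f = 0"
proof (cases "p = \<infinity>")
  case True
  have "esssup M (\<lambda>x. ennreal \<bar>f x\<bar>) \<le> 0"
    using f by (intro esssup_I) (auto elim: eventually_mono)
  then show ?thesis using True by (simp add: Lp_norm_def)
next
  case False
  have "(\<integral>\<^sup>+ x. ennreal (\<bar>f x\<bar> powr enn2real p) \<partial>M) = (\<integral>\<^sup>+ x. 0 \<partial>M)"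
    using f by (intro nn_integral_cong_AE) (auto elim: eventually_mono)
  then show ?thesis using False by (simp add: Lp_norm_def ennpowr_def)
qed

lemma ennpowr_le:
  assumes "x \<le> ennreal B" "0 \<le> B" "0 \<le> a"
  shows "ennpowr x a \<le> ennreal (B powr a)"
proof (cases x)
  case (real i)
  then show ?thesis using assms by (auto simp: ennpowr_def intro!: ennreal_leI powr_mono2)
next
  case top
  then show ?thesis using assms by (simp add: top_unique)
qed

lemma avg_weight_le:
  fixes p :: ennreal
  assumes E: "E \<in> sets M" "0 < measure M E" and r: "0 < r" and p: "0 < p"
    and [measurable]: "w \<in> borel_measurable M" "u \<in> borel_measurable M"
    and w: "AE x in M. 0 < w x" and A: "avg M (ennreal r) E w \<le> ennreal A" "0 < A"
    and u: "AE x in M. x \<in> E \<longrightarrow> B \<le> u x" and B: "0 < B" and b: "0 \<le> b"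
  defines "a \<equiv> enn2real (inverse p)"
  shows "avg M (ennreal r * p) E (\<lambda>x. w x powr a * u x powr - b) \<le> ennreal (A powr a * B powr - b)"
proof (cases p)
  case top
  note [measurable] = E(1)
  have a: "a = 0" using top by (simp add: a_def)
  have rp: "ennreal r * p = \<infinity>" using r top by (simp add: ennreal_mult_top)
  have "esssup M (\<lambda>x. ennreal \<bar>w x powr a * u x powr - b * indicator E x\<bar>) \<le> ennreal (B powr - b)"
  proof (rule esssup_I)
    show "AE x in M. ennreal \<bar>w x powr a * u x powr - b * indicator E x\<bar> \<le> ennreal (B powr - b)"
      using u w
    proof eventually_elim
      case (elim x)
      then show ?case using B b a by (intro ennreal_leI) (auto intro!: powr_mono2' split: split_indicator)
    qed
  qed measurable
  then show ?thesis using A(2) E(2) a by (simp add: avg_def rp Lp_norm_def)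
next
  case (real s)
  note [measurable] = E(1)
  have s: "0 < s" using p real by auto
  have a: "a = 1 / s" using s real by (simp add: a_def inverse_ennreal inverse_eq_divide)
  have rs: "ennreal r * p = ennreal (r * s)" using r real by (simp add: ennreal_mult)
  let ?k = "B powr (- b * (r * s))"
  have "(\<integral>\<^sup>+ x. ennreal (\<bar>w x powr a * u x powr - b\<bar> powr (r * s)) * indicator E x \<partial>M)
    \<le> (\<integral>\<^sup>+ x. ennreal ?k * (ennreal (\<bar>w x\<bar> powr r) * indicator E x) \<partial>M)"
    using u w
  proof (intro nn_integral_mono_AE, eventually_elim)
    case (elim x)
    show ?case
    proof (cases "x \<in> E")
      case True
      have "(u x powr - b) powr (r * s) \<le> (B powr - b) powr (r * s)"
        using elim True B b r s by (intro powr_mono2 powr_mono2') auto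
      then have "w x powr r * (u x powr - b) powr (r * s) \<le> w x powr r * ?k"
        by (intro mult_left_mono) (auto simp: powr_powr)
      moreover have "\<bar>w x powr a * u x powr - b\<bar> powr (r * s) = w x powr r * (u x powr - b) powr (r * s)"
        using s by (simp add: abs_of_nonneg powr_mult powr_powr a)
      ultimately show ?thesis using True elim by (simp add: ennreal_mult[symmetric] ennreal_leI mult.commute)
    qed simp
  qed
  also have "\<dots> = ennreal ?k * (\<integral>\<^sup>+ x. ennreal (\<bar>w x\<bar> powr r) * indicator E x \<partial>M)"
    by (rule nn_integral_cmult) measurable
  also have "\<dots> \<le> ennreal ?k * ennreal (A powr r * measure M E)"
    using A avg_le_iff[OF E r, of A w] by (intro mult_left_mono) auto
  also have "\<dots> = ennreal ((A powr a * B powr - b) powr (r * s) * measure M E)"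
    using s by (simp add: ennreal_mult'[symmetric] powr_mult powr_powr a mult_ac)
  finally show ?thesis
    unfolding rs using r s by (subst avg_le_iff[OF E]) auto
qed

text \<open>
  The average of \<open>w\<close> over \<open>E\<close> is positive because \<open>E\<close> has positive measure, and it is finite
  because \<open>E\<close> contains points at which the maximal function is at most the real number \<open>c * u x\<close>.
\<close>

lemma avg_bounds:
  assumes \<E>: "set_basis M \<E>" and E: "E \<in> \<E>" and r: "0 < r"
    and [measurable]: "w \<in> borel_measurable M"
    and w: "AE x in M. 0 < w x" and Mw: "AE x in M. maximal_op M \<E> (ennreal r) w x \<le> ennreal (c * u x)"
    and u: "AE x in M. 0 < u x" and c: "0 < c"
  obtains A where "0 < A" "avg M (ennreal r) E w = ennreal A" "AE x in M. x \<in> E \<longrightarrow> A / c \<le> u x"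
proof -
  note E' = set_basisD[OF \<E> E]
  note [measurable] = E'(1)
  have notnull: "\<not> (AE x in M. x \<notin> E)"
    using E' AE_iff_null_sets[of E M] by (auto simp: null_sets_def)
  have le: "AE x in M. x \<in> E \<longrightarrow> avg M (ennreal r) E w \<le> ennreal (c * u x)"
    using Mw by eventually_elim (use E in \<open>auto simp: maximal_op_le_iff\<close>)
  show ?thesis
  proof (cases "avg M (ennreal r) E w")
    case top
    have "AE x in M. x \<notin> E" using le by eventually_elim (auto simp: top top_unique)
    with notnull show ?thesis ..
  next
    case (real A)
    have "A \<noteq> 0"
    proof
      assume "A = 0"
      then have "avg M (ennreal r) E w \<le> ennreal 0" using real by simp
      then have "(\<integral>\<^sup>+ x. ennreal (\<bar>w x\<bar> powr r) * indicator E x \<partial>M) = 0"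
        using r by (subst (asm) avg_le_iff[OF E'(1,4)]) auto
      then have "AE x in M. ennreal (\<bar>w x\<bar> powr r) * indicator E x = 0"
        by (subst (asm) nn_integral_0_iff_AE) auto
      then have "AE x in M. x \<notin> E" using w by eventually_elim (auto split: split_indicator_asm)
      with notnull show False ..
    qed
    moreover have "AE x in M. x \<in> E \<longrightarrow> A / c \<le> u x"
      using le u
    proof eventually_elim
      case (elim x)
      show ?case
      proof
        assume "x \<in> E"
        with elim have "ennreal A \<le> ennreal (c * u x)" using real by simp
        then have "A \<le> c * u x" using elim(2) c by (subst (asm) ennreal_le_iff) auto
        then show "A / c \<le> u x" using c by (simp add: field_simps)
      qed
    qed
    ultimately show ?thesis using real that by simp
  qed
qed

text \<open>
  Over each \<open>E\<close> the averages of \<open>w1\<close> and of \<open>w2\<close> cancel in the product of the two bounds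
  given by the preceding lemmas.
\<close>

lemma weight_averages_le:
  fixes q1 q2 :: ennreal
  assumes \<E>: "set_basis M \<E>" and r: "0 < r1" "0 < r2" and q: "0 < q1" "0 < q2"
    and [measurable]: "w1 \<in> borel_measurable M" "w2 \<in> borel_measurable M"
      "u1 \<in> borel_measurable M" "u2 \<in> borel_measurable M"
    and w: "AE x in M. 0 < w1 x" "AE x in M. 0 < w2 x"
    and u: "AE x in M. 0 < u1 x" "AE x in M. 0 < u2 x" and c: "0 < c1" "0 < c2"
    and M1: "AE x in M. maximal_op M \<E> (ennreal r1) w1 x \<le> ennreal (c1 * u1 x)"
    and M2: "AE x in M. maximal_op M \<E> (ennreal r2) w2 x \<le> ennreal (c2 * u2 x)"
  defines "a1 \<equiv> enn2real (inverse q1)" and "a2 \<equiv> enn2real (inverse q2)"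
  shows "(SUP E\<in>\<E>. avg M (ennreal r1 * q2) E (\<lambda>x. w1 x powr a2 * u2 x powr - a1)
      * avg M (ennreal r2 * q1) E (\<lambda>x. w2 x powr a1 * u1 x powr - a2)) \<le> ennreal (c1 powr a2 * c2 powr a1)"
proof (rule SUP_least)
  fix E assume E: "E \<in> \<E>"
  note E' = set_basisD[OF \<E> E]
  obtain A1 where A1: "0 < A1" "avg M (ennreal r1) E w1 = ennreal A1" "AE x in M. x \<in> E \<longrightarrow> A1 / c1 \<le> u1 x"
    by (rule avg_bounds[OF \<E> E r(1) _ w(1) M1 u(1) c(1)]) auto
  obtain A2 where A2: "0 < A2" "avg M (ennreal r2) E w2 = ennreal A2" "AE x in M. x \<in> E \<longrightarrow> A2 / c2 \<le> u2 x"
    by (rule avg_bounds[OF \<E> E r(2) _ w(2) M2 u(2) c(2)]) auto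
  have "avg M (ennreal r1 * q2) E (\<lambda>x. w1 x powr a2 * u2 x powr - a1) \<le> ennreal (A1 powr a2 * (A2 / c2) powr - a1)"
    unfolding a2_def using A1 A2 c by (intro avg_weight_le E' r q w) (auto simp: a1_def)
  moreover have "avg M (ennreal r2 * q1) E (\<lambda>x. w2 x powr a1 * u1 x powr - a2) \<le> ennreal (A2 powr a1 * (A1 / c1) powr - a2)"
    unfolding a1_def using A1 A2 c by (intro avg_weight_le E' r q w) (auto simp: a2_def)
  ultimately have "avg M (ennreal r1 * q2) E (\<lambda>x. w1 x powr a2 * u2 x powr - a1)
      * avg M (ennreal r2 * q1) E (\<lambda>x. w2 x powr a1 * u1 x powr - a2)
     \<le> ennreal (A1 powr a2 * (A2 / c2) powr - a1) * ennreal (A2 powr a1 * (A1 / c1) powr - a2)"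
    by (rule mult_mono) auto
  also have "\<dots> = ennreal (c1 powr a2 * c2 powr a1)"
    using A1 A2 c by (simp add: ennreal_mult[symmetric] powr_divide powr_minus field_simps)
  finally show "avg M (ennreal r1 * q2) E (\<lambda>x. w1 x powr a2 * u2 x powr - a1)
      * avg M (ennreal r2 * q1) E (\<lambda>x. w2 x powr a1 * u1 x powr - a2) \<le> ennreal (c1 powr a2 * c2 powr a1)" .
qed

text \<open>
  The bound \<open>\<bar>f\<bar> powr q \<le> w\<close> absorbs the negative power of \<open>w\<close>: for finite \<open>p = s\<close> the identity
  \<open>s = q + q * b * s\<close> turns \<open>\<bar>f\<bar> powr s * w powr (- b * s)\<close> into at most \<open>\<bar>f\<bar> powr q\<close>. If \<open>b = 0\<close>
  there is nothing to absorb, and for \<open>p = \<infinity>\<close> the whole function is bounded by \<open>1\<close>.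
\<close>

lemma Lp_norm_weight_le:
  fixes p :: ennreal
  assumes p: "0 < p" and q: "0 < q" "1 / q = enn2real (inverse p) + b" and b: "0 \<le> b"
    and [measurable]: "f \<in> borel_measurable M" "w \<in> borel_measurable M" "u \<in> borel_measurable M"
    and w: "AE x in M. 0 < w x" and u: "AE x in M. 0 < u x"
    and fw: "b \<noteq> 0 \<Longrightarrow> AE x in M. \<bar>f x\<bar> powr q \<le> w x"
    and B: "0 \<le> B" and fu: "p \<noteq> \<infinity> \<Longrightarrow> (\<integral>\<^sup>+ x. ennreal (\<bar>f x\<bar> powr q * u x) \<partial>M) \<le> ennreal B"
  defines "a \<equiv> enn2real (inverse p)"
  shows "Lp_norm M p (\<lambda>x. f x * (w x powr - b * u x powr a)) \<le> ennreal (powr1 B a)"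
proof -
  have fw': "AE x in M. (\<bar>f x\<bar> powr q) powr b * w x powr - b \<le> 1"
  proof (cases "b = 0")
    case False
    show ?thesis
      using fw[OF False] w
    proof eventually_elim
      case (elim x)
      then have "(\<bar>f x\<bar> powr q) powr b \<le> w x powr b" using b by (intro powr_mono2) auto
      then show ?case using elim by (simp add: powr_minus field_simps)
    qed
  qed (auto intro: AE_I2)
  show ?thesis
  proof (cases p)
    case top
    have a: "a = 0" using top by (simp add: a_def)
    have qb: "q * b = 1" using q a by (simp add: a_def field_simps)
    have "esssup M (\<lambda>x. ennreal \<bar>f x * (w x powr - b * u x powr a)\<bar>) \<le> ennreal 1"
    proof (rule esssup_I)
      show "AE x in M. ennreal \<bar>f x * (w x powr - b * u x powr a)\<bar> \<le> ennreal 1"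
        using fw' u
        by eventually_elim (auto simp: abs_mult a powr_powr qb)
    qed measurable
    then show ?thesis using a top by (simp add: Lp_norm_def powr1_def)
  next
    case (real s)
    have s: "0 < s" using p real by auto
    have a: "a = 1 / s" using s real by (simp add: a_def inverse_ennreal inverse_eq_divide)
    have sq: "s = q + q * (b * s)" using q s by (simp add: a[unfolded a_def] field_simps)
    have "(\<integral>\<^sup>+ x. ennreal (\<bar>f x * (w x powr - b * u x powr a)\<bar> powr s) \<partial>M)
      \<le> (\<integral>\<^sup>+ x. ennreal (\<bar>f x\<bar> powr q * u x) \<partial>M)"
      using fw' u
    proof (intro nn_integral_mono_AE, eventually_elim)
      case (elim x)
      have "((\<bar>f x\<bar> powr q) powr b * w x powr - b) powr s \<le> 1 powr s"
        using elim s by (intro powr_mono2) auto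
      then have 1: "\<bar>f x\<bar> powr (q * (b * s)) * w x powr (- b * s) \<le> 1"
        by (simp add: powr_mult powr_powr mult.assoc)
      have "\<bar>f x * (w x powr - b * u x powr a)\<bar> powr s = \<bar>f x\<bar> powr s * (w x powr (- b * s) * u x)"
        using elim s by (simp add: abs_mult powr_mult powr_powr a)
      also have "\<bar>f x\<bar> powr s = \<bar>f x\<bar> powr q * \<bar>f x\<bar> powr (q * (b * s))"
        by (subst sq) (rule powr_add)
      also have "\<bar>f x\<bar> powr q * \<bar>f x\<bar> powr (q * (b * s)) * (w x powr (- b * s) * u x)
        = (\<bar>f x\<bar> powr q * u x) * (\<bar>f x\<bar> powr (q * (b * s)) * w x powr (- b * s))" by (simp only: mult_ac)
      also have "\<dots> \<le> (\<bar>f x\<bar> powr q * u x) * 1"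
        using 1 elim by (intro mult_left_mono) auto
      finally show ?case by (intro ennreal_leI) simp
    qed
    also have "\<dots> \<le> ennreal B" using real by (intro fu) auto
    finally show ?thesis
      using ennpowr_le[of _ B "1/s"] B s real by (simp add: Lp_norm_def powr1_def a)
  qed
qed

lemma maximal_op_one:
  assumes \<E>: "set_basis M \<E>" and r: "0 < r"
  shows "maximal_op M \<E> (ennreal r) (\<lambda>_. 1) x \<le> 1"
proof -
  have "avg M (ennreal r) E (\<lambda>_. 1) \<le> ennreal 1" if "E \<in> \<E>" for E
  proof -
    note E = set_basisD[OF \<E> that]
    show ?thesis
      using E r by (subst avg_le_iff[OF E(1,4) r]) (auto simp: emeasure_eq_ennreal_measure)
  qed
  then show ?thesis by (simp add: maximal_op_le_iff)
qed

text \<open>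
  One half of the construction. The exponent \<open>p = \<infinity>\<close>, for which nothing is known about the
  maximal operator, is covered by constants. If \<open>F\<close> vanishes almost everywhere, the iteration
  is applied to another function, because weights have to be positive.
\<close>

lemma majorant:
  fixes p :: ennreal
  assumes \<E>: "set_basis M \<E>" "\<E> \<noteq> {}" and r: "0 < r" and p: "0 < p" and Y: "banach_fspace M Y"
    and L: "p \<noteq> \<infinity> \<Longrightarrow> positive_isometry M Y Z L"
    and bd: "p \<noteq> \<infinity> \<Longrightarrow> op_bounded M Y Z (maximal_op M \<E> (ennreal r))"
    and F: "F \<in> fcarrier Y"
  defines "a \<equiv> enn2real (inverse p)" and "K \<equiv> op_norm Y Z (maximal_op M \<E> (ennreal r))"
  obtains w u c where "w \<in> borel_measurable M" "u \<in> borel_measurable M"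
    "AE x in M. 0 < w x" "AE x in M. 0 < u x" "0 < c"
    "AE x in M. maximal_op M \<E> (ennreal r) w x \<le> ennreal (c * u x)"
    "c powr a = 2 powr a * powr1 K a" "L = (\<lambda>f. f) \<longrightarrow> u = w"
    "p \<noteq> \<infinity> \<longrightarrow> \<not> (AE x in M. F x = 0) \<longrightarrow>
      (AE x in M. \<bar>F x\<bar> \<le> w x) \<and> u \<in> fcarrier Z \<and> fnorm Z u \<le> 2 * fnorm Y F"
proof (cases "p = \<infinity>")
  case True
  show ?thesis
    by (rule that[of "\<lambda>_. 1" "\<lambda>_. 1" 1])
      (use True maximal_op_one[OF \<E>(1) r] in \<open>auto simp: a_def powr1_def\<close>)
next
  case False
  interpret positive_isometry M Y Z L by (rule L[OF False])
  have a: "a \<noteq> 0" using False p enn2real_inverse_eq_0_iff by (simp add: a_def)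
  have "\<exists>G\<in>fcarrier Y. \<not> (AE x in M. G x = 0)"
  proof -
    obtain E where E: "E \<in> \<E>" using \<E>(2) by blast
    note E' = set_basisD[OF \<E>(1) E]
    from Y.saturated[OF E'(1,2)] obtain B where B: "B \<in> sets M" "0 < emeasure M B" "indicator B \<in> fcarrier Y"
      by blast
    then show ?thesis
      using Y.norm_indicator_pos[OF B] Y.norm_null(2)[of "indicator B"] by force
  qed
  then obtain G where G: "G \<in> fcarrier Y" "\<not> (AE x in M. G x = 0)"
    and GF: "\<not> (AE x in M. F x = 0) \<Longrightarrow> G = F" using F by blast
  obtain w where w: "w \<in> fcarrier Y" "fnorm Y w \<le> 2 * fnorm Y G" "AE x in M. \<bar>G x\<bar> \<le> w x"
    "AE x in M. 0 < w x" "AE x in M. 0 < L w x"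
    "AE x in M. maximal_op M \<E> (ennreal r) w x \<le> ennreal (2 * K * L w x)" "0 < K"
    unfolding K_def using rubio_de_francia[OF \<E>(1) r bd[OF False] G] by blast
  show ?thesis
    by (rule that[of w "L w" "2 * K"])
      (use w a GF L_mem[OF w(1)] L_norm[OF w(1)] Y.meas Z.meas in \<open>auto simp: powr1_def powr_mult\<close>)
qed

text \<open>
  The common core of both parts. Let \<open>w1\<close> and \<open>w2\<close> be majorants of \<open>\<bar>f1\<bar> powr q\<close> and
  \<open>\<bar>f2\<bar> powr q\<close> with images \<open>u1\<close> and \<open>u2\<close> under the isometries, put \<open>a1 = 1 / q1\<close> and
  \<open>a2 = 1 / q2\<close>, and take the weights \<open>W1 = w1 powr - a2 * u2 powr a1\<close> and
  \<open>W2 = w2 powr - a1 * u1 powr a2\<close>. For finite exponents, \<open>\<bar>f1\<bar> powr q \<le> w1\<close> shows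
  \<open>\<bar>f1 * W1\<bar> powr q1 \<le> \<bar>f1\<bar> powr q * u2\<close>, whose integral is at most \<open>B\<close>, the product of the
  norm of \<open>\<bar>f1\<bar> powr q\<close> and twice that of \<open>\<bar>f2\<bar> powr q\<close>; the same \<open>B\<close> arises for the
  other factor, and \<open>B powr a1 * B powr a2 = B powr (1 / q)\<close>. Only one of the two majorants
  is left in each integral, so \<open>B\<close> contains the factor \<open>2\<close> once. For an infinite exponent,
  the corresponding majorant and its image are constants.

  For \<open>L1 = (\<lambda>f. f)\<close> and \<open>L2 = (\<lambda>f. f)\<close> the two weights are reciprocal to each other.
\<close>

lemma weight_factorization:
  fixes q1 q2 :: ennreal and r1 r2 q :: real
  assumes \<E>: "set_basis M \<E>" and r: "0 < r1" "0 < r2" and qs: "0 < q1" "0 < q2" "0 < q"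
    and qsum: "ennreal (1 / q) = inverse q1 + inverse q2"
    and Y1: "banach_fspace M Y1" and Y2: "banach_fspace M Y2"
    and L1: "q2 \<noteq> \<infinity> \<Longrightarrow> positive_isometry M Y1 Z1 L1"
    and L2: "q1 \<noteq> \<infinity> \<Longrightarrow> positive_isometry M Y2 Z2 L2"
    and bd1: "q2 \<noteq> \<infinity> \<Longrightarrow> op_bounded M Y1 Z1 (maximal_op M \<E> (ennreal r1))"
    and bd2: "q1 \<noteq> \<infinity> \<Longrightarrow> op_bounded M Y2 Z2 (maximal_op M \<E> (ennreal r2))"
    and hoelder1: "\<And>f u. f \<in> fcarrier Y1 \<Longrightarrow> u \<in> fcarrier Z2 \<Longrightarrow>
       (\<integral>\<^sup>+ x. ennreal \<bar>f x * u x\<bar> \<partial>M) \<le> ennreal (fnorm Y1 f * fnorm Z2 u)"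
    and hoelder2: "\<And>f u. f \<in> fcarrier Y2 \<Longrightarrow> u \<in> fcarrier Z1 \<Longrightarrow>
       (\<integral>\<^sup>+ x. ennreal \<bar>f x * u x\<bar> \<partial>M) \<le> ennreal (fnorm Y2 f * fnorm Z1 u)"
    and [measurable]: "f1 \<in> borel_measurable M" "f2 \<in> borel_measurable M"
    and F1: "(\<lambda>x. \<bar>f1 x\<bar> powr q) \<in> fcarrier Y1" and F2: "(\<lambda>x. \<bar>f2 x\<bar> powr q) \<in> fcarrier Y2"
  defines "a1 \<equiv> enn2real (inverse q1)" and "a2 \<equiv> enn2real (inverse q2)"
    and "K1 \<equiv> op_norm Y1 Z1 (maximal_op M \<E> (ennreal r1))"
    and "K2 \<equiv> op_norm Y2 Z2 (maximal_op M \<E> (ennreal r2))"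
  obtains w1 w2 u1 u2 where
    "w1 \<in> borel_measurable M" "w2 \<in> borel_measurable M" "u1 \<in> borel_measurable M" "u2 \<in> borel_measurable M"
    "AE x in M. 0 < w1 x" "AE x in M. 0 < w2 x" "AE x in M. 0 < u1 x" "AE x in M. 0 < u2 x"
    "L1 = (\<lambda>f. f) \<longrightarrow> u1 = w1" "L2 = (\<lambda>f. f) \<longrightarrow> u2 = w2"
    "(SUP E\<in>\<E>. avg M (ennreal r1 * q2) E (\<lambda>x. w1 x powr a2 * u2 x powr - a1)
        * avg M (ennreal r2 * q1) E (\<lambda>x. w2 x powr a1 * u1 x powr - a2))
      \<le> ennreal (2 powr (1 / q) * powr1 K1 a2 * powr1 K2 a1)"
    "Lp_norm M q1 (\<lambda>x. f1 x * (w1 x powr - a2 * u2 x powr a1))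
        * Lp_norm M q2 (\<lambda>x. f2 x * (w2 x powr - a1 * u1 x powr a2))
      \<le> ennreal ((2 * fnorm Y1 (\<lambda>x. \<bar>f1 x\<bar> powr q) * fnorm Y2 (\<lambda>x. \<bar>f2 x\<bar> powr q)) powr (1 / q))"
proof (cases "\<E> = {}")
  case True
  then have "space M = {}" using \<E> by (auto simp: set_basis_def)
  then have null: "AE x in M. P x" for P by (auto intro: AE_I2)
  then have "Lp_norm M p f = 0" if "f \<in> borel_measurable M" for p f by (intro Lp_norm_null that)
  then show ?thesis using True null by (intro that[of "\<lambda>_. 1" "\<lambda>_. 1" "\<lambda>_. 1" "\<lambda>_. 1"]) (auto simp: bot_ennreal)
next
  case False
  let ?F1 = "\<lambda>x. \<bar>f1 x\<bar> powr q" and ?F2 = "\<lambda>x. \<bar>f2 x\<bar> powr q"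
  have fin: "inverse p < top" if "0 < p" for p :: ennreal
    using that by (cases p) (auto simp: inverse_ennreal)
  have a12: "1 / q = a1 + a2"
  proof -
    have "ennreal (1 / q) = ennreal (a1 + a2)"
      using qsum fin[OF qs(1)] fin[OF qs(2)] by (simp add: a1_def a2_def)
    then show ?thesis using qs by (subst (asm) ennreal_inj) (auto simp: a1_def a2_def)
  qed
  have a0: "0 \<le> a1" "0 \<le> a2" by (auto simp: a1_def a2_def)
  have a1: "a1 = 0 \<longleftrightarrow> q1 = \<infinity>" and a2: "a2 = 0 \<longleftrightarrow> q2 = \<infinity>"
    unfolding a1_def a2_def using qs by (auto simp only: enn2real_inverse_eq_0_iff)
  obtain w1 u1 c1 where 1: "w1 \<in> borel_measurable M" "u1 \<in> borel_measurable M"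
    "AE x in M. 0 < w1 x" "AE x in M. 0 < u1 x" "0 < c1"
    "AE x in M. maximal_op M \<E> (ennreal r1) w1 x \<le> ennreal (c1 * u1 x)"
    "c1 powr a2 = 2 powr a2 * powr1 K1 a2" "L1 = (\<lambda>f. f) \<longrightarrow> u1 = w1"
    "q2 \<noteq> \<infinity> \<longrightarrow> \<not> (AE x in M. ?F1 x = 0) \<longrightarrow>
      (AE x in M. \<bar>?F1 x\<bar> \<le> w1 x) \<and> u1 \<in> fcarrier Z1 \<and> fnorm Z1 u1 \<le> 2 * fnorm Y1 ?F1"
    unfolding a2_def K1_def by (rule majorant[OF \<E> False r(1) qs(2) Y1 L1 bd1 F1])
  obtain w2 u2 c2 where 2: "w2 \<in> borel_measurable M" "u2 \<in> borel_measurable M"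
    "AE x in M. 0 < w2 x" "AE x in M. 0 < u2 x" "0 < c2"
    "AE x in M. maximal_op M \<E> (ennreal r2) w2 x \<le> ennreal (c2 * u2 x)"
    "c2 powr a1 = 2 powr a1 * powr1 K2 a1" "L2 = (\<lambda>f. f) \<longrightarrow> u2 = w2"
    "q1 \<noteq> \<infinity> \<longrightarrow> \<not> (AE x in M. ?F2 x = 0) \<longrightarrow>
      (AE x in M. \<bar>?F2 x\<bar> \<le> w2 x) \<and> u2 \<in> fcarrier Z2 \<and> fnorm Z2 u2 \<le> 2 * fnorm Y2 ?F2"
    unfolding a1_def K2_def by (rule majorant[OF \<E> False r(2) qs(1) Y2 L2 bd2 F2])
  note [measurable] = 1(1,2) 2(1,2)
  define B where "B = 2 * fnorm Y1 ?F1 * fnorm Y2 ?F2"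
  have n0: "0 \<le> fnorm Y1 ?F1" "0 \<le> fnorm Y2 ?F2"
    using banach_fspace.norm_nonneg Y1 Y2 F1 F2 by blast+
  have B0: "0 \<le> B" using n0 by (simp add: B_def)
  have averages: "(SUP E\<in>\<E>. avg M (ennreal r1 * q2) E (\<lambda>x. w1 x powr a2 * u2 x powr - a1)
        * avg M (ennreal r2 * q1) E (\<lambda>x. w2 x powr a1 * u1 x powr - a2))
      \<le> ennreal (2 powr (1 / q) * powr1 K1 a2 * powr1 K2 a1)"
  proof -
    have "c1 powr a2 * c2 powr a1 = 2 powr (1 / q) * powr1 K1 a2 * powr1 K2 a1"
      unfolding 1(7) 2(7) a12 powr_add by (simp only: mult_ac)
    then show ?thesis
      using weight_averages_le[OF \<E> r qs(1,2) 1(1) 2(1) 1(2) 2(2) 1(3) 2(3) 1(4) 2(4) 1(5) 2(5) 1(6) 2(6)]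
      unfolding a1_def a2_def by simp
  qed
  have norms: "Lp_norm M q1 (\<lambda>x. f1 x * (w1 x powr - a2 * u2 x powr a1))
        * Lp_norm M q2 (\<lambda>x. f2 x * (w2 x powr - a1 * u1 x powr a2)) \<le> ennreal (B powr (1 / q))"
  proof (cases "(AE x in M. ?F1 x = 0) \<or> (AE x in M. ?F2 x = 0)")
    case True
    then show ?thesis
    proof
      assume "AE x in M. ?F1 x = 0"
      then have "Lp_norm M q1 (\<lambda>x. f1 x * (w1 x powr - a2 * u2 x powr a1)) = 0"
        by (intro Lp_norm_null) (measurable, auto elim: eventually_mono)
      then show ?thesis by simp
    next
      assume "AE x in M. ?F2 x = 0"
      then have "Lp_norm M q2 (\<lambda>x. f2 x * (w2 x powr - a1 * u1 x powr a2)) = 0"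
        by (intro Lp_norm_null) (measurable, auto elim: eventually_mono)
      then show ?thesis by simp
    qed
  next
    case nz: False
    have "(\<integral>\<^sup>+ x. ennreal (\<bar>f1 x\<bar> powr q * u2 x) \<partial>M) \<le> ennreal B" if q1: "q1 \<noteq> \<infinity>"
    proof -
      have u2: "u2 \<in> fcarrier Z2" "fnorm Z2 u2 \<le> 2 * fnorm Y2 ?F2" using 2(9) q1 nz by auto
      have "(\<integral>\<^sup>+ x. ennreal (\<bar>f1 x\<bar> powr q * u2 x) \<partial>M) \<le> (\<integral>\<^sup>+ x. ennreal \<bar>?F1 x * u2 x\<bar> \<partial>M)"
        by (intro nn_integral_mono ennreal_leI) auto
      also have "\<dots> \<le> ennreal (fnorm Y1 ?F1 * fnorm Z2 u2)" by (rule hoelder1[OF F1 u2(1)])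
      also have "\<dots> \<le> ennreal (fnorm Y1 ?F1 * (2 * fnorm Y2 ?F2))"
        using u2 n0 by (intro ennreal_leI mult_left_mono)
      finally show ?thesis by (simp add: B_def mult_ac)
    qed
    then have N1: "Lp_norm M q1 (\<lambda>x. f1 x * (w1 x powr - a2 * u2 x powr a1)) \<le> ennreal (powr1 B a1)"
      unfolding a1_def using 1(9) nz a2 a0
      by (intro Lp_norm_weight_le[OF qs(1,3) a12[unfolded a1_def] _ _ _ _ 1(3) 2(4) _ B0]) auto
    have "(\<integral>\<^sup>+ x. ennreal (\<bar>f2 x\<bar> powr q * u1 x) \<partial>M) \<le> ennreal B" if q2: "q2 \<noteq> \<infinity>"
    proof -
      have u1: "u1 \<in> fcarrier Z1" "fnorm Z1 u1 \<le> 2 * fnorm Y1 ?F1" using 1(9) q2 nz by auto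
      have "(\<integral>\<^sup>+ x. ennreal (\<bar>f2 x\<bar> powr q * u1 x) \<partial>M) \<le> (\<integral>\<^sup>+ x. ennreal \<bar>?F2 x * u1 x\<bar> \<partial>M)"
        by (intro nn_integral_mono ennreal_leI) auto
      also have "\<dots> \<le> ennreal (fnorm Y2 ?F2 * fnorm Z1 u1)" by (rule hoelder2[OF F2 u1(1)])
      also have "\<dots> \<le> ennreal (fnorm Y2 ?F2 * (2 * fnorm Y1 ?F1))"
        using u1 n0 by (intro ennreal_leI mult_left_mono)
      finally show ?thesis by (simp add: B_def mult_ac)
    qed
    then have N2: "Lp_norm M q2 (\<lambda>x. f2 x * (w2 x powr - a1 * u1 x powr a2)) \<le> ennreal (powr1 B a2)"
      unfolding a2_def using 2(9) nz a1 a0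
      by (intro Lp_norm_weight_le[OF qs(2,3) a12[unfolded a2_def, unfolded add.commute[of a1]] _ _ _ _ 2(3) 1(4) _ B0]) auto
    have "powr1 B a1 * powr1 B a2 = B powr (1 / q)"
      using a12 a0 qs(3) by (auto simp: powr1_def powr_add)
    moreover have "0 \<le> powr1 B a1" by (simp add: powr1_def)
    ultimately show ?thesis using mult_mono[OF N1 N2] by (simp add: ennreal_mult'[symmetric])
  qed
  show ?thesis
    by (rule that[of w1 w2 u1 u2]) (use 1 2 averages norms in \<open>auto simp: B_def\<close>)
qed

lemma concavification_abs_powr:
  assumes X: "qbfs M X" and q: "0 < q" and f: "f \<in> fcarrier X"
  shows "f \<in> borel_measurable M" "0 \<le> fnorm X f"
    "(\<lambda>x. \<bar>f x\<bar> powr q) \<in> fcarrier (concavification M X q)"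
    "fnorm (concavification M X q) (\<lambda>x. \<bar>f x\<bar> powr q) = fnorm X f powr q"
proof -
  have qn: "quasi_normed_fspace M X" using X by (simp add: qbfs_def)
  show m[measurable]: "f \<in> borel_measurable M" and "0 \<le> fnorm X f"
    using qn f by (auto simp: quasi_normed_fspace_def)
  note ideal = X[unfolded qbfs_def, THEN conjunct2, THEN conjunct1, rule_format]
  have abs: "(\<lambda>x. \<bar>f x\<bar>) \<in> fcarrier X \<and> fnorm X (\<lambda>x. \<bar>f x\<bar>) \<le> fnorm X f"
    by (rule ideal[OF f]) auto
  then have "fnorm X f \<le> fnorm X (\<lambda>x. \<bar>f x\<bar>)"
    by (intro conjunct2[OF ideal]) auto
  then show "(\<lambda>x. \<bar>f x\<bar> powr q) \<in> fcarrier (concavification M X q)"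
    "fnorm (concavification M X q) (\<lambda>x. \<bar>f x\<bar> powr q) = fnorm X f powr q"
    using abs q by (auto simp: concavification_def powr_powr)
qed

section \<open>Factorization of products by weights\<close>

theorem theorem4p1:
  fixes M :: "'a measure" and \<E> :: "'a set set"
    and r1 r2 q :: real and q1 q2 :: ennreal
  assumes "sigma_finite_measure M"
    and "set_basis M \<E>"
    and "1 \<le> r1" and "1 \<le> r2"
    and "0 < q1" and "0 < q2"
    and "0 < q" and "ennreal (1 / q) = inverse q1 + inverse q2"
  shows "(\<forall>X1 X2 :: 'a fspace.
      qbfs M X1 \<and> q_convex q X1 \<and> qbfs M X2 \<and> q_convex q X2 \<and>
      (q2 \<noteq> \<infinity> \<longrightarrow>
        (\<exists>L1. positive_isometric_iso M
                (concavification M X1 q) (koethe_dual M (concavification M X2 q)) L1) \<and>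
        op_bounded M (concavification M X1 q) (koethe_dual M (concavification M X2 q))
          (maximal_op M \<E> (ennreal r1))) \<and>
      (q1 \<noteq> \<infinity> \<longrightarrow>
        (\<exists>L2. positive_isometric_iso M
                (concavification M X2 q) (koethe_dual M (concavification M X1 q)) L2) \<and>
        op_bounded M (concavification M X2 q) (koethe_dual M (concavification M X1 q))
          (maximal_op M \<E> (ennreal r2)))
      \<longrightarrow> (\<forall>f1\<in>fcarrier X1. \<forall>f2\<in>fcarrier X2. \<exists>W1 W2. weight M W1 \<and> weight M W2 \<and>
            (SUP E\<in>\<E>. avg M (ennreal r1 * q2) E (\<lambda>x. inverse (W1 x))
                      * avg M (ennreal r2 * q1) E (\<lambda>x. inverse (W2 x)))
              \<le> ennreal (2 powr (1 / q)
                  * powr1 (op_norm (concavification M X1 q)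
                             (koethe_dual M (concavification M X2 q))
                             (maximal_op M \<E> (ennreal r1))) (enn2real (inverse q2))
                  * powr1 (op_norm (concavification M X2 q)
                             (koethe_dual M (concavification M X1 q))
                             (maximal_op M \<E> (ennreal r2))) (enn2real (inverse q1))) \<and>
            Lp_norm M q1 (\<lambda>x. f1 x * W1 x) * Lp_norm M q2 (\<lambda>x. f2 x * W2 x)
              \<le> ennreal (2 powr (1 / q) * fnorm X1 f1 * fnorm X2 f2)))
    \<and>
    (\<forall>X :: 'a fspace.
      qbfs M X \<and> q_convex q X \<and>
      (q2 \<noteq> \<infinity> \<longrightarrow>
        op_bounded M (concavification M X q) (concavification M X q)
          (maximal_op M \<E> (ennreal r1))) \<and>
      (q1 \<noteq> \<infinity> \<longrightarrow>
        op_bounded M (koethe_dual M (concavification M X q))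
          (koethe_dual M (concavification M X q)) (maximal_op M \<E> (ennreal r2)))
      \<longrightarrow> (\<forall>f\<in>fcarrier X.
           \<forall>g\<in>fcarrier (concavification M (koethe_dual M (concavification M X q)) (1 / q)).
           \<exists>W. weight M W \<and>
            (SUP E\<in>\<E>. avg M (ennreal r2 * q1) E W
                      * avg M (ennreal r1 * q2) E (\<lambda>x. inverse (W x)))
              \<le> ennreal (2 powr (1 / q)
                  * powr1 (op_norm (concavification M X q) (concavification M X q)
                             (maximal_op M \<E> (ennreal r1))) (enn2real (inverse q2))
                  * powr1 (op_norm (koethe_dual M (concavification M X q))
                             (koethe_dual M (concavification M X q))
                             (maximal_op M \<E> (ennreal r2))) (enn2real (inverse q1))) \<and>
            Lp_norm M q1 (\<lambda>x. f x * W x) * Lp_norm M q2 (\<lambda>x. g x * inverse (W x))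
              \<le> ennreal (2 powr (1 / q) * fnorm X f
                  * fnorm (concavification M (koethe_dual M (concavification M X q)) (1 / q)) g)))"
proof (intro conjI allI impI ballI; (elim conjE)?)
  note qs = assms(5,6,7)
  have r: "0 < r1" "0 < r2" using assms(3,4) by auto
  fix X1 X2 :: "'a fspace" and f1 f2
  assume X1: "qbfs M X1" "q_convex q X1" and X2: "qbfs M X2" "q_convex q X2"
    and h1: "q2 \<noteq> \<infinity> \<longrightarrow>
        (\<exists>L1. positive_isometric_iso M
                (concavification M X1 q) (koethe_dual M (concavification M X2 q)) L1) \<and>
        op_bounded M (concavification M X1 q) (koethe_dual M (concavification M X2 q))
          (maximal_op M \<E> (ennreal r1))"
    and h2: "q1 \<noteq> \<infinity> \<longrightarrow>
        (\<exists>L2. positive_isometric_iso M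
                (concavification M X2 q) (koethe_dual M (concavification M X1 q)) L2) \<and>
        op_bounded M (concavification M X2 q) (koethe_dual M (concavification M X1 q))
          (maximal_op M \<E> (ennreal r2))"
    and f: "f1 \<in> fcarrier X1" "f2 \<in> fcarrier X2"
  let ?Y1 = "concavification M X1 q" and ?Y2 = "concavification M X2 q"
  interpret Y1: banach_fspace M ?Y1 by (rule banach_fspace_concavification[OF assms(1) X1 qs(3)])
  interpret Y2: banach_fspace M ?Y2 by (rule banach_fspace_concavification[OF assms(1) X2 qs(3)])
  interpret D1: banach_fspace M "koethe_dual M ?Y1" by (rule Y1.banach_fspace_dual)
  interpret D2: banach_fspace M "koethe_dual M ?Y2" by (rule Y2.banach_fspace_dual)
  note F1 = concavification_abs_powr[OF X1(1) qs(3) f(1)]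
  note F2 = concavification_abs_powr[OF X2(1) qs(3) f(2)]
  obtain L1 where L1: "q2 \<noteq> \<infinity> \<Longrightarrow> positive_isometry M ?Y1 (koethe_dual M ?Y2) L1"
    using h1 Y1.banach_fspace_axioms D2.banach_fspace_axioms
    by (auto simp: positive_isometry_def positive_isometry_axioms_def)
  obtain L2 where L2: "q1 \<noteq> \<infinity> \<Longrightarrow> positive_isometry M ?Y2 (koethe_dual M ?Y1) L2"
    using h2 Y2.banach_fspace_axioms D1.banach_fspace_axioms
    by (auto simp: positive_isometry_def positive_isometry_axioms_def)
  let ?a1 = "enn2real (inverse q1)" and ?a2 = "enn2real (inverse q2)"
  let ?K1 = "op_norm ?Y1 (koethe_dual M ?Y2) (maximal_op M \<E> (ennreal r1))"
  let ?K2 = "op_norm ?Y2 (koethe_dual M ?Y1) (maximal_op M \<E> (ennreal r2))"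
  obtain w1 w2 u1 u2 where
    [measurable]: "w1 \<in> borel_measurable M" "w2 \<in> borel_measurable M" "u1 \<in> borel_measurable M" "u2 \<in> borel_measurable M"
    and pos: "AE x in M. 0 < w1 x" "AE x in M. 0 < w2 x" "AE x in M. 0 < u1 x" "AE x in M. 0 < u2 x"
    and averages: "(SUP E\<in>\<E>. avg M (ennreal r1 * q2) E (\<lambda>x. w1 x powr ?a2 * u2 x powr - ?a1)
        * avg M (ennreal r2 * q1) E (\<lambda>x. w2 x powr ?a1 * u1 x powr - ?a2))
      \<le> ennreal (2 powr (1 / q) * powr1 ?K1 ?a2 * powr1 ?K2 ?a1)"
    and norms: "Lp_norm M q1 (\<lambda>x. f1 x * (w1 x powr - ?a2 * u2 x powr ?a1))
        * Lp_norm M q2 (\<lambda>x. f2 x * (w2 x powr - ?a1 * u1 x powr ?a2))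
      \<le> ennreal ((2 * fnorm ?Y1 (\<lambda>x. \<bar>f1 x\<bar> powr q) * fnorm ?Y2 (\<lambda>x. \<bar>f2 x\<bar> powr q)) powr (1 / q))"
    by (rule weight_factorization[OF assms(2) r qs assms(8) Y1.banach_fspace_axioms Y2.banach_fspace_axioms
          L1 L2 _ _ Y1.koethe_hoelder Y2.koethe_hoelder F1(1) F2(1) F1(3) F2(3)])
       (use h1 h2 in auto)
  define W1 where "W1 x = w1 x powr - ?a2 * u2 x powr ?a1" for x
  define W2 where "W2 x = w2 x powr - ?a1 * u1 x powr ?a2" for x
  have inv: "inverse (W1 x) = w1 x powr ?a2 * u2 x powr - ?a1" "inverse (W2 x) = w2 x powr ?a1 * u1 x powr - ?a2" for x
    by (simp_all add: W1_def W2_def powr_minus)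
  have "weight M W1"
    unfolding weight_def W1_def[abs_def] using pos(1,4) by (auto elim!: eventually_elim2)
  moreover have "weight M W2"
    unfolding weight_def W2_def[abs_def] using pos(2,3) by (auto elim!: eventually_elim2)
  moreover have "(2 * fnorm ?Y1 (\<lambda>x. \<bar>f1 x\<bar> powr q) * fnorm ?Y2 (\<lambda>x. \<bar>f2 x\<bar> powr q)) powr (1 / q)
      = 2 powr (1 / q) * fnorm X1 f1 * fnorm X2 f2"
    using qs(3) F1(2) F2(2) by (simp add: F1(4) F2(4) powr_mult powr_powr)
  ultimately show "\<exists>W1 W2. weight M W1 \<and> weight M W2 \<and>
            (SUP E\<in>\<E>. avg M (ennreal r1 * q2) E (\<lambda>x. inverse (W1 x))
                      * avg M (ennreal r2 * q1) E (\<lambda>x. inverse (W2 x)))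
              \<le> ennreal (2 powr (1 / q) * powr1 ?K1 ?a2 * powr1 ?K2 ?a1) \<and>
            Lp_norm M q1 (\<lambda>x. f1 x * W1 x) * Lp_norm M q2 (\<lambda>x. f2 x * W2 x)
              \<le> ennreal (2 powr (1 / q) * fnorm X1 f1 * fnorm X2 f2)"
    using averages norms
    by (intro exI[of _ W1] exI[of _ W2]) (simp add: inv, simp add: W1_def W2_def)
next
  note qs = assms(5,6,7)
  have r: "0 < r1" "0 < r2" using assms(3,4) by auto
  fix X :: "'a fspace" and f g
  let ?Y = "concavification M X q"
  let ?D = "koethe_dual M ?Y"
  assume X: "qbfs M X" "q_convex q X"
    and h1: "q2 \<noteq> \<infinity> \<longrightarrow> op_bounded M ?Y ?Y (maximal_op M \<E> (ennreal r1))"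
    and h2: "q1 \<noteq> \<infinity> \<longrightarrow> op_bounded M ?D ?D (maximal_op M \<E> (ennreal r2))"
    and f: "f \<in> fcarrier X" and g: "g \<in> fcarrier (concavification M ?D (1 / q))"
  interpret Y: banach_fspace M ?Y by (rule banach_fspace_concavification[OF assms(1) X qs(3)])
  interpret D: banach_fspace M ?D by (rule Y.banach_fspace_dual)
  note F = concavification_abs_powr[OF X(1) qs(3) f]
  have gm: "g \<in> borel_measurable M" and G: "(\<lambda>x. \<bar>g x\<bar> powr q) \<in> fcarrier ?D"
    using g by (auto simp: concavification_def)
  have gn: "fnorm (concavification M ?D (1 / q)) g = fnorm ?D (\<lambda>x. \<bar>g x\<bar> powr q) powr (1 / q)"
    by (simp add: concavification_def)
  let ?a1 = "enn2real (inverse q1)" and ?a2 = "enn2real (inverse q2)"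
  let ?K1 = "op_norm ?Y ?Y (maximal_op M \<E> (ennreal r1))"
  let ?K2 = "op_norm ?D ?D (maximal_op M \<E> (ennreal r2))"
  have hoelder': "(\<integral>\<^sup>+ x. ennreal \<bar>v x * u x\<bar> \<partial>M) \<le> ennreal (fnorm ?D v * fnorm ?Y u)"
    if "v \<in> fcarrier ?D" "u \<in> fcarrier ?Y" for u v
    using Y.koethe_hoelder[OF that(2,1)] by (simp add: mult.commute)
  obtain w1 w2 u1 u2 where
    [measurable]: "w1 \<in> borel_measurable M" "w2 \<in> borel_measurable M" 
    and pos: "AE x in M. 0 < w1 x" "AE x in M. 0 < w2 x"
    and u: "u1 = w1" "u2 = w2"
    and averages: "(SUP E\<in>\<E>. avg M (ennreal r1 * q2) E (\<lambda>x. w1 x powr ?a2 * u2 x powr - ?a1)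
        * avg M (ennreal r2 * q1) E (\<lambda>x. w2 x powr ?a1 * u1 x powr - ?a2))
      \<le> ennreal (2 powr (1 / q) * powr1 ?K1 ?a2 * powr1 ?K2 ?a1)"
    and norms: "Lp_norm M q1 (\<lambda>x. f x * (w1 x powr - ?a2 * u2 x powr ?a1))
        * Lp_norm M q2 (\<lambda>x. g x * (w2 x powr - ?a1 * u1 x powr ?a2))
      \<le> ennreal ((2 * fnorm ?Y (\<lambda>x. \<bar>f x\<bar> powr q) * fnorm ?D (\<lambda>x. \<bar>g x\<bar> powr q)) powr (1 / q))"
    by (rule weight_factorization[OF assms(2) r qs assms(8) Y.banach_fspace_axioms D.banach_fspace_axioms
          Y.positive_isometry_id D.positive_isometry_id _ _ Y.koethe_hoelder hoelder' F(1) gm F(3) G])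
       (use h1 h2 in auto)
  define W where "W x = w1 x powr - ?a2 * w2 x powr ?a1" for x
  have inv: "inverse (W x) = w1 x powr ?a2 * w2 x powr - ?a1" for x
    by (simp add: W_def powr_minus)
  have "weight M W"
    unfolding weight_def W_def[abs_def] using pos by (auto elim!: eventually_elim2)
  moreover have "(2 * fnorm ?Y (\<lambda>x. \<bar>f x\<bar> powr q) * fnorm ?D (\<lambda>x. \<bar>g x\<bar> powr q)) powr (1 / q)
      = 2 powr (1 / q) * fnorm X f * fnorm (concavification M ?D (1 / q)) g"
    using qs(3) F(2) unfolding gn by (simp add: F(4) powr_mult powr_powr)
  ultimately show "\<exists>W. weight M W \<and>
            (SUP E\<in>\<E>. avg M (ennreal r2 * q1) E W * avg M (ennreal r1 * q2) E (\<lambda>x. inverse (W x)))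
              \<le> ennreal (2 powr (1 / q) * powr1 ?K1 ?a2 * powr1 ?K2 ?a1) \<and>
            Lp_norm M q1 (\<lambda>x. f x * W x) * Lp_norm M q2 (\<lambda>x. g x * inverse (W x))
              \<le> ennreal (2 powr (1 / q) * fnorm X f * fnorm (concavification M ?D (1 / q)) g)"
    using averages norms
    by (intro exI[of _ W]) (simp only: u inv, simp add: W_def[abs_def] mult.commute)
qed

end
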